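(* Let $\gamma>1$ and let $K$ be a kernel satisfying Assumption (K) (stated in the context) with exponent $\gamma$. Let $f_{\mathrm{in}}$ be a non-negative Radon measure on $(0,\infty)$ and let $T>0$. Then the coagulation equation with kernel $K$ and initial datum $f_{\mathrm{in}}$ admits a mass-conserving solution on $[0,T]$ if and only if $f_{\mathrm{in}}=M\delta_V$ for some $M,V\in(0,\infty)$.
   Context: Notation. $\mathscr{M}_+((0,\infty))$ is the set of non-negative Radon measures on $(0,\infty)$; for a measure $f$ one writes $f(v)\,dv$ even if it is not absolutely continuous. For $\beta>0$, $\mathscr{M}_+((0,\infty),1+v^\beta)$ is the set of $f\in\mathscr{M}_+((0,\infty))$ with $\int_{(0,\infty)}(1+v^\beta)f(v)\,dv<\infty$. $\delta_V$ is the unit Dirac mass at $V$. Assumption (K) (with exponent $\gamma>1$). The kernel $K:[0,\infty)\times[0,\infty)\to[0,\infty)$ has the form $K(v,v')=h(v,v')\,g\big(\tfrac{v}{v+v'}\big)$, where $g\in C([0,\infty))$ and $h\in C([0,\infty)^2)$ satisfy: (i) $h$ is symmetric, and there are $H>1$ and $H_0>0$ with $H_0(v^\gamma+v'^\gamma)\le h(v,v')$ whenever $v+v'>H$; (ii) for every $R>0$ there is $C_R>0$ with $h(v,v')\ge C_R$ for all $v,v'\in[\tfrac1R,R]$; (iii) there is $H_1>0$ with $h(v,v')\le H_1(v^\gamma+v'^\gamma)$ for all $v,v'\in[0,\infty)$; (iv) $g(x)=g(1-x)$ for $x\in[0,1]$, $g(\tfrac12)=0$, and there are $G_0,G_1>0$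 and $k\ge1$ with $G_0|x-\tfrac12|^k\le g(x)\le G_1$ for all $x\in[0,1]$. The coagulation equation is $\partial_t f(v,t)=\frac12\int_{(0,v)}K(v-v',v')f(v-v',t)f(v',t)\,dv'-\int_{(0,\infty)}K(v,v')f(v,t)f(v',t)\,dv'$. Weak solution. Let $T\in(0,\infty]$ ($[0,T]$ means $[0,\infty)$ if $T=\infty$). A weak solution on $[0,T]$ with initial datum $f_{\mathrm{in}}$ is $f\in C([0,T];\mathscr{M}_+((0,\infty),1+v^\gamma))$ (continuity in time understood in the vague topology, i.e. tested against $C_c((0,\infty))$) such that $\sup_{t\in[0,T]}\int_{(0,\infty)}(1+v^\gamma)f(v,t)\,dv<\infty$ and, for every $\varphi\in C_c((0,\infty))$ and every $t\in[0,T]$, $$\int_{(0,\infty)}f(v,t)\varphi(v)\,dv-\int_{(0,\infty)}f_{\mathrm{in}}(v)\varphi(v)\,dv=\frac12\int_0^t\int_{(0,\infty)}\int_{(0,\infty)}K(v,v')\,[\varphi(v+v')-\varphi(v)-\varphi(v')]\,f(v,s)f(v',s)\,dv\,dv'\,ds.$$ Mass-conserving solution. For $T>0$, a mass-conserving solution on $[0,T]$ is a weak solution on $[0,T]$ with $\int_{(0,\infty)}v f(v,t)\,dv=\int_{(0,\infty)}v f_{\mathrm{in}}(v)\,dv$ for all $t\in[0,T]$.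
   Formalization: The initial datum is assumed to be non-zero: for the zero measure the zero solution is mass-conserving, but the zero measure is not of the form MδV with M > 0, so the "only if" part fails for it. *)

theory Defs
  imports "HOL-Probability.Probability"
begin

text \<open>Measures on \<open>(0,\<infinity>)\<close> are measures whose underlying space is \<open>{0<..}\<close> itself (not measures
  on \<open>\<real>\<close>), so integrals against them are integrals over \<open>(0,\<infinity>)\<close>.\<close>

abbreviation pos_borel :: "real measure" where
  "pos_borel \<equiv> restrict_space borel {0<..}"

definition radon_measure :: "real measure \<Rightarrow> bool" where
  "radon_measure \<mu> \<longleftrightarrow>
     sets \<mu> = sets pos_borel \<and>
     (\<forall>C. compact C \<and> C \<subseteq> {0<..} \<longrightarrow> emeasure \<mu> C < \<infinity>) \<and>
     (\<forall>A\<in>sets \<mu>. emeasure \<mu> A = (SUP C\<in>{C. compact C \<and> C \<subseteq> A}. emeasure \<mu> C))"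

definition radon_measure_weighted :: "real \<Rightarrow> real measure \<Rightarrow> bool" where
  "radon_measure_weighted \<beta> \<mu> \<longleftrightarrow>
     radon_measure \<mu> \<and> (\<integral>\<^sup>+v. ennreal (1 + v powr \<beta>) \<partial>\<mu>) < \<infinity>"

text \<open>Only the values of a test function on \<open>(0,\<infinity>)\<close> matter; what it does elsewhere is arbitrary.\<close>

definition Cc_pos :: "(real \<Rightarrow> real) set" where
  "Cc_pos = {\<phi>. continuous_on {0<..} \<phi> \<and>
     (\<exists>C. compact C \<and> C \<subseteq> {0<..} \<and> (\<forall>v\<in>{0<..} - C. \<phi> v = 0))}"

definition dirac_mass :: "real \<Rightarrow> real measure" where
  "dirac_mass V = return pos_borel V"

text \<open>The quotient in \<open>g\<close> is \<open>0/0\<close> at the origin. Its value there is immaterial: (ii), (iii) and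
  continuity force \<open>h 0 0 = 0\<close>, and the origin is not charged by measures on \<open>(0,\<infinity>)\<close>.
  At \<open>x = 1/2\<close> the lower bound on \<open>g\<close> is \<open>0\<close>, since \<open>0 powr k = 0\<close>.\<close>

definition assumption_K :: "real \<Rightarrow> (real \<Rightarrow> real \<Rightarrow> real) \<Rightarrow> bool" where
  "assumption_K \<gamma> K \<longleftrightarrow>
     (\<forall>v\<ge>0. \<forall>w\<ge>0. 0 \<le> K v w) \<and>
     (\<exists>h g.
        continuous_on ({0..} \<times> {0..}) (\<lambda>(v, w). h v w) \<and>
        continuous_on {0..} g \<and>
        (\<forall>v\<ge>0. \<forall>w\<ge>0. K v w = h v w * g (v / (v + w))) \<and>
        \<comment> \<open>(i)\<close>
        (\<forall>v\<ge>0. \<forall>w\<ge>0. h v w = h w v) \<and>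
        (\<exists>H>1. \<exists>H0>0. \<forall>v\<ge>0. \<forall>w\<ge>0. v + w > H \<longrightarrow> H0 * (v powr \<gamma> + w powr \<gamma>) \<le> h v w) \<and>
        \<comment> \<open>(ii)\<close>
        (\<forall>R>0. \<exists>C>0. \<forall>v\<in>{1/R..R}. \<forall>w\<in>{1/R..R}. C \<le> h v w) \<and>
        \<comment> \<open>(iii)\<close>
        (\<exists>H1>0. \<forall>v\<ge>0. \<forall>w\<ge>0. h v w \<le> H1 * (v powr \<gamma> + w powr \<gamma>)) \<and>
        \<comment> \<open>(iv)\<close>
        (\<forall>x\<in>{0..1}. g x = g (1 - x)) \<and>
        g (1/2) = 0 \<and>
        (\<exists>G0>0. \<exists>G1>0. \<exists>k\<ge>1. \<forall>x\<in>{0..1}.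
           G0 * \<bar>x - 1/2\<bar> powr k \<le> g x \<and> g x \<le> G1))"

text \<open>\<open>[0,T]\<close> for \<open>T \<in> (0,\<infinity>]\<close>, read as \<open>[0,\<infinity>)\<close> if \<open>T = \<infinity>\<close>.\<close>

definition time_interval :: "ereal \<Rightarrow> real set" where
  "time_interval T = {t. 0 \<le> t \<and> ereal t \<le> T}"

text \<open>The uniform \<open>1 + v\<^sup>\<gamma>\<close> moment bound and the growth bound on the kernel make the Bochner
  integrals below genuine, i.e. the integrands are integrable. The values \<open>f t\<close> for
  \<open>t\<close> outside the time interval are irrelevant.\<close>

definition weak_solution ::
  "real \<Rightarrow> (real \<Rightarrow> real \<Rightarrow> real) \<Rightarrow> ereal \<Rightarrow> real measure \<Rightarrow> (real \<Rightarrow> real measure) \<Rightarrow> bool" where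
  "weak_solution \<gamma> K T f_in f \<longleftrightarrow>
     (\<forall>t\<in>time_interval T. radon_measure_weighted \<gamma> (f t)) \<and>
     (\<forall>\<phi>\<in>Cc_pos. continuous_on (time_interval T) (\<lambda>t. \<integral>v. \<phi> v \<partial>f t)) \<and>
     (SUP t\<in>time_interval T. \<integral>\<^sup>+v. ennreal (1 + v powr \<gamma>) \<partial>f t) < \<infinity> \<and>
     (\<forall>\<phi>\<in>Cc_pos. \<forall>t\<in>time_interval T.
        (\<integral>v. \<phi> v \<partial>f t) - (\<integral>v. \<phi> v \<partial>f_in) =
        1/2 * (\<integral>s\<in>{0..t}.
                 (\<integral>w. (\<integral>v. K v w * (\<phi> (v + w) - \<phi> v - \<phi> w) \<partial>f s) \<partial>f s) \<partial>lborel))"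

definition mass_conserving_solution ::
  "real \<Rightarrow> (real \<Rightarrow> real \<Rightarrow> real) \<Rightarrow> real \<Rightarrow> real measure \<Rightarrow> (real \<Rightarrow> real measure) \<Rightarrow> bool" where
  "mass_conserving_solution \<gamma> K T f_in f \<longleftrightarrow>
     weak_solution \<gamma> K (ereal T) f_in f \<and>
     (\<forall>t\<in>time_interval (ereal T). (\<integral>\<^sup>+v. ennreal v \<partial>f t) = (\<integral>\<^sup>+v. ennreal v \<partial>f_in))"

end

theory Submission
  imports Defs
begin

text \<open>A point mass is stationary, because its particles only meet on the diagonal, where the kernel vanishes
(\<open>dirac_stationary\<close>). Conversely, suppose that a solution exists whose initial datum charges two different
sizes \<open>x\<close> and \<open>y\<close>. Then mass escapes to infinity within an arbitrarily short time, for the following reasons.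

Off the diagonal the kernel is positive. So once different sizes are charged, their sum is charged at every
later time (\<open>charged_add\<close>), and since \<open>y + k * x\<close> and \<open>x\<close> are again different, the support of the solution is
unbounded at every positive time. Moreover, particles of a bounded size are lost at a bounded rate, so that an
amount of particles of size about \<open>x\<close> remains available (\<open>obs_positive\<close>).

A particle of large size \<open>v\<close> absorbs these small particles at a rate of order \<open>v powr \<gamma>\<close>. In terms of the tails
\<open>y n t\<close>, the integral of \<open>max 0 (v - n)\<close> against the solution at time \<open>t\<close>, this is the differential
inequality \<open>d/dt y (n + d) \<ge> c * n powr \<gamma> * (y n - y (n + d))\<close> with \<open>d = x / 2\<close> (\<open>tail_rate_lower\<close>). Along
the levels \<open>n = (j + k) * d\<close> it describes a pure-birth chain. As \<open>\<gamma> > 1\<close>, the sum of the mean waiting times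
\<open>1 / (c * n powr \<gamma>)\<close> is finite, and it is as small as desired if the chain starts at a large level \<open>j\<close>. Such a
chain explodes: a fixed share of the tail at the first level, which is positive since the support is unbounded,
would have passed every level within a short time (\<open>explosive_chain_extinct\<close>). But the tails of a measure
with a finite first moment tend to 0.

Hence the initial datum charges at most one size, and being a nonzero Radon measure it is a multiple of a point
mass (\<open>dirac_if_charged_unique\<close>).

The analytic work lies in admitting the tails as test functions. They are limits of compactly supported functions
which are 1-Lipschitz and vanish at 0. For such functions the collision term is dominated by a product of
\<open>\<gamma>\<close>-moment weights, uniformly, so dominated convergence applies (\<open>dominated_collision\<close>, \<open>balanced_limit\<close>).\<close>

section \<open>Integral inequalities in time\<close>

lemma set_integrable_Ioc_continuous:
  fixes u :: "real \<Rightarrow> real"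
  assumes "continuous_on {a..b} u" "a \<le> s" "t \<le> b"
  shows "set_integrable lborel {s<..t} u"
proof -
  have "set_integrable lborel {a..b} u"
    by (rule borel_integrable_compact[OF compact_Icc assms(1), folded set_integrable_def])
  then show ?thesis
    by (rule set_integrable_subset) (use assms in auto)
qed

lemma set_integral_Ioc_le:
  fixes u :: "real \<Rightarrow> real"
  assumes "set_integrable lborel {s<..t} u" "s \<le> t" "\<And>r. s < r \<Longrightarrow> r \<le> t \<Longrightarrow> u r \<le> c"
  shows "(LBINT r:{s<..t}. u r) \<le> c * (t - s)"
proof -
  have "(LBINT r:{s<..t}. u r) \<le> (LBINT r:{s<..t}. c)"
    using assms by (intro set_integral_mono) (auto simp: set_integrable_def)
  also have "\<dots> = c * (t - s)"
    using assms by (simp add: set_integral_const measure_def)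
  finally show ?thesis .
qed

text \<open>A function that can lose at most \<open>C\<close> times its own integral cannot reach zero: just before its
first zero, on an interval of length \<open>h \<le> 1 / (2 * C)\<close>, it would lose at most half of its maximum
there, although it has to lose all of it. This is the qualitative form of
Gronwall's inequality \<open>u t \<ge> exp (- C * (t - s)) * u s\<close>.\<close>

lemma positive_if_linear_loss:
  fixes u :: "real \<Rightarrow> real"
  assumes cont: "continuous_on {a..b} u"
    and nonneg: "\<And>r. r \<in> {a..b} \<Longrightarrow> 0 \<le> u r"
    and "0 \<le> C"
    and loss: "\<And>r t. a \<le> r \<Longrightarrow> r \<le> t \<Longrightarrow> t \<le> b \<Longrightarrow> u r - C * (LBINT q:{r<..t}. u q) \<le> u t"
    and "a \<le> s" "s \<le> t" "t \<le> b" "0 < u s"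
  shows "0 < u t"
proof (rule ccontr)
  assume "\<not> 0 < u t"
  moreover have "0 \<le> u t" using assms by (intro nonneg) auto
  ultimately have ut: "u t = 0" by simp
  define Z where "Z = {r \<in> {s..t}. u r = 0}"
  have "continuous_on {s..t} u" using cont assms by (auto elim: continuous_on_subset)
  then have "closed Z" unfolding Z_def
    by (intro continuous_closed_preimage_constant) auto
  moreover have "bounded Z" by (rule bounded_subset[of "{s..t}"]) (auto simp: Z_def)
  ultimately have "compact Z" by (simp add: compact_eq_bounded_closed)
  moreover have "Z \<noteq> {}" using ut assms by (auto simp: Z_def)
  ultimately obtain z where z: "z \<in> Z" "\<And>r. r \<in> Z \<Longrightarrow> z \<le> r"
    using compact_attains_inf[of Z] by auto
  have zs: "s < z" "z \<le> t" "u z = 0" using z(1) \<open>0 < u s\<close> by (auto simp: Z_def less_le)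
  \<comment> \<open>Using \<open>C + 1\<close> keeps \<open>h\<close> finite when \<open>C = 0\<close>.\<close>
  define h where "h = 1 / (2 * (C + 1))"
  have h: "0 < h" "C * h \<le> 1/2" using \<open>0 \<le> C\<close> by (auto simp: h_def field_simps)
  define l where "l = max s (z - h)"
  have l: "s \<le> l" "l < z" "z - h \<le> l" using h zs by (auto simp: l_def)
  have "continuous_on {l..z} u" using cont assms l zs by (auto elim!: continuous_on_subset)
  then obtain p where p: "p \<in> {l..z}" "\<And>r. r \<in> {l..z} \<Longrightarrow> u r \<le> u p"
    using continuous_attains_sup[of "{l..z}" u] l by auto
  have up: "0 \<le> u p" using nonneg p l zs assms by auto
  have "(LBINT q:{p<..z}. u q) \<le> u p * (z - p)"
    using p l zs assms
    by (intro set_integral_Ioc_le set_integrable_Ioc_continuous[OF cont]) auto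
  also have "\<dots> \<le> u p * h" using p l up by (intro mult_left_mono) auto
  finally have "C * (LBINT q:{p<..z}. u q) \<le> C * (u p * h)"
    using \<open>0 \<le> C\<close> by (rule mult_left_mono)
  also have "\<dots> = (C * h) * u p" by simp
  also have "\<dots> \<le> 1/2 * u p" using h up by (intro mult_right_mono)
  finally have "u p \<le> 1/2 * u p" using loss[of p z] p l zs assms by auto
  moreover have "0 \<le> u l" using l zs assms by (intro nonneg) auto
  moreover have "u l \<le> u p" using l by (intro p) auto
  ultimately have "u l = 0" by simp
  then have "l \<in> Z" using l zs by (auto simp: Z_def)
  with z(2) l show False by fastforce
qed

text \<open>Read \<open>y k t\<close> as the mass that has reached stage \<open>k\<close> of a pure-birth chain which leaves stage \<open>k\<close> at
rate \<open>\<mu> k\<close>. The expected time to run through all stages is the sum of the \<open>1 / \<mu> k\<close>. If that is less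
than the length of the time interval, a positive share of the mass present at stage 0 at time \<open>a\<close> has passed
all stages at time \<open>b\<close>; this is incompatible with \<open>y k b\<close> tending to 0, unless there was no mass.

For the proof, let \<open>c = y 0 a\<close> and truncate at this level, \<open>z k = min (y k) c\<close>. As long as \<open>y (Suc k)\<close> has
not reached \<open>c\<close>, it gains at most \<open>c\<close>, so that the integral of \<open>z k - z (Suc k)\<close> is at most \<open>c / \<mu> k\<close>; after
that time \<open>z (Suc k) = c\<close>, so the difference is not positive. Since \<open>z 0 = c\<close> throughout and the
integrals of \<open>z k\<close> tend to 0, summing over \<open>k\<close> gives \<open>c * (b - a) \<le> c * (\<Sum>k. 1 / \<mu> k)\<close>.\<close>

lemma explosive_chain_extinct:
  fixes y :: "nat \<Rightarrow> real \<Rightarrow> real" and \<mu> :: "nat \<Rightarrow> real"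
  assumes cont: "\<And>k. continuous_on {a..b} (y k)"
    and mono: "\<And>k s t. a \<le> s \<Longrightarrow> s \<le> t \<Longrightarrow> t \<le> b \<Longrightarrow> y k s \<le> y k t"
    and nonneg: "\<And>k t. t \<in> {a..b} \<Longrightarrow> 0 \<le> y k t"
    and lim: "(\<lambda>k. y k b) \<longlonglongrightarrow> 0"
    and \<mu>: "\<And>k. 0 < \<mu> k" "summable (\<lambda>k. 1 / \<mu> k)" "(\<Sum>k. 1 / \<mu> k) < b - a"
    and grow: "\<And>k t. a \<le> t \<Longrightarrow> t \<le> b \<Longrightarrow>
      \<mu> k * (LBINT r:{a<..t}. y k r - y (Suc k) r) \<le> y (Suc k) t - y (Suc k) a"
  shows "y 0 a = 0"
proof (rule ccontr)
  assume "y 0 a \<noteq> 0"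
  have "0 \<le> (\<Sum>k. 1 / \<mu> k)" using \<mu> by (intro suminf_nonneg) (auto simp: less_imp_le)
  with \<mu> have ab: "a < b" by simp
  define c where "c = y 0 a"
  have c: "0 < c" using nonneg[of a 0] ab \<open>y 0 a \<noteq> 0\<close> by (auto simp: c_def)
  define z where "z k r = min (y k r) c" for k r
  have zc: "continuous_on {a..b} (z k)" for k
    unfolding z_def by (intro continuous_intros cont)
  define I where "I k = (LBINT r:{a<..b}. z k r)" for k
  note int = set_integrable_Ioc_continuous
  have step: "I k - I (Suc k) \<le> c * (1 / \<mu> k)" for k
  proof -
    define S where "S = {r \<in> {a..b}. y (Suc k) r \<le> c}"
    have diff: "I k - I (Suc k) = (LBINT r:{a<..b}. z k r - z (Suc k) r)"
      unfolding I_def by (intro set_integral_diff(2)[symmetric] int[OF zc]) auto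
    have intd: "set_integrable lborel {a<..b} (\<lambda>r. z k r - z (Suc k) r)"
      by (intro set_integral_diff(1) int[OF zc]) auto
    show ?thesis
    proof (cases "S = {}")
      case True
      then have "y (Suc k) r > c" if "r \<in> {a..b}" for r using that by (force simp: S_def)
      then have "I k - I (Suc k) \<le> 0 * (b - a)" unfolding diff
        using ab by (intro set_integral_Ioc_le intd) (auto simp: z_def)
      also have "\<dots> \<le> c * (1 / \<mu> k)" using c \<mu>(1)[of k] by simp
      finally show ?thesis .
    next
      case False
      have "S = {a..b} \<inter> y (Suc k) -` {..c}" by (auto simp: S_def)
      then have "closed S" by (simp add: continuous_closed_preimage[OF cont])
      moreover have "bounded S" by (rule bounded_subset[of "{a..b}"]) (auto simp: S_def)
      ultimately have "compact S" by (simp add: compact_eq_bounded_closed)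
      \<comment> \<open>\<open>\<tau>\<close> is the last time at which \<open>y (Suc k)\<close> has not exceeded \<open>c\<close>.\<close>
      then obtain \<tau> where \<tau>: "\<tau> \<in> S" "\<And>r. r \<in> S \<Longrightarrow> r \<le> \<tau>"
        using compact_attains_sup[of S] False by auto
      have \<tau>': "a \<le> \<tau>" "\<tau> \<le> b" "y (Suc k) \<tau> \<le> c" using \<tau> by (auto simp: S_def)
      have le: "indicator {a<..b} r * (z k r - z (Suc k) r)
          \<le> indicator {a<..\<tau>} r * (y k r - y (Suc k) r)" for r
      proof (cases "r \<in> {a<..b}")
        case r: True
        show ?thesis
        proof (cases "r \<le> \<tau>")
          case True
          with r mono[of r \<tau> "Suc k"] \<tau>' have "y (Suc k) r \<le> c" by auto
          with True r show ?thesis by (auto simp: z_def)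
        next
          case False
          then have "r \<notin> S" using \<tau>(2) by force
          with r have "c < y (Suc k) r" by (auto simp: S_def)
          with False r show ?thesis by (auto simp: z_def)
        qed
      next
        case False
        with \<tau>' show ?thesis by auto
      qed
      have "set_integrable lborel {a<..\<tau>} (\<lambda>r. y k r - y (Suc k) r)"
        using \<tau>' by (intro set_integral_diff(1) int[OF cont]) auto
      with intd have "I k - I (Suc k) \<le> (LBINT r:{a<..\<tau>}. y k r - y (Suc k) r)"
        unfolding diff set_lebesgue_integral_def set_integrable_def
        by (intro integral_mono) (auto simp: le)
      also have "\<dots> \<le> (y (Suc k) \<tau> - y (Suc k) a) / \<mu> k"
        using grow[of \<tau> k] \<mu>(1)[of k] \<tau>' by (simp add: pos_le_divide_eq mult.commute)
      also have "\<dots> \<le> c / \<mu> k"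
        using nonneg[of a "Suc k"] ab \<tau>' \<mu>(1)[of k] by (intro divide_right_mono) auto
      finally show ?thesis by simp
    qed
  qed
  have tele: "I 0 - I n \<le> c * (\<Sum>k. 1 / \<mu> k)" for n
  proof -
    have "I 0 - I n = (\<Sum>k<n. I k - I (Suc k))" by (simp add: sum_lessThan_telescope')
    also have "\<dots> \<le> (\<Sum>k<n. c * (1 / \<mu> k))" by (intro sum_mono step)
    also have "\<dots> = c * (\<Sum>k<n. 1 / \<mu> k)" by (simp add: sum_distrib_left)
    also have "\<dots> \<le> c * (\<Sum>k. 1 / \<mu> k)"
      using c \<mu> by (intro mult_left_mono sum_le_suminf) (auto simp: less_imp_le)
    finally show ?thesis .
  qed
  have I0: "I 0 = c * (b - a)"
  proof -
    have "I 0 = (LBINT r:{a<..b}. c)" unfolding I_def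
      using mono[of a _ 0] by (intro set_lebesgue_integral_cong) (auto simp: z_def c_def)
    also have "\<dots> = c * (b - a)" using ab by (simp add: set_integral_const measure_def)
    finally show ?thesis .
  qed
  have In: "I n \<le> y n b * (b - a)" for n unfolding I_def
    using ab mono[of _ b n] by (intro set_integral_Ioc_le int[OF zc]) (auto simp: z_def min_le_iff_disj)
  have bound: "c * (b - a) - c * (\<Sum>k. 1 / \<mu> k) \<le> y n b * (b - a)" for n
    using tele[of n] In[of n] I0 by linarith
  have "(\<lambda>n. y n b * (b - a)) \<longlonglongrightarrow> 0 * (b - a)"
    by (intro tendsto_intros lim)
  then have "c * (b - a) - c * (\<Sum>k. 1 / \<mu> k) \<le> 0 * (b - a)"
    by (rule Lim_bounded2[where N = 0]) (simp add: bound)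
  then have "c * (b - a) \<le> c * (\<Sum>k. 1 / \<mu> k)" by simp
  with c have "b - a \<le> (\<Sum>k. 1 / \<mu> k)" by simp
  with \<mu> show False by simp
qed

section \<open>Measures with a finite moment\<close>

text \<open>For a 1-Lipschitz \<open>\<phi>\<close> with \<open>\<phi> 0 = 0\<close>, the increment \<open>\<phi> (v + w) - \<phi> v - \<phi> w\<close> is, in absolute
value, at most \<open>2 * min v w\<close>. So the increment costs at most one power of the smaller size, and its product with
a kernel of growth \<open>v powr \<gamma> + w powr \<gamma>\<close> is integrable against any measure with a finite integral of
\<open>1 + v powr \<gamma>\<close>, although \<open>\<phi>\<close> itself may grow linearly.\<close>

definition lip0 :: "(real \<Rightarrow> real) set" where
  "lip0 = {\<phi>. \<phi> 0 = 0 \<and> (\<forall>x y. \<bar>\<phi> x - \<phi> y\<bar> \<le> \<bar>x - y\<bar>)}"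

lemma lip0_diff: "\<phi> \<in> lip0 \<Longrightarrow> \<bar>\<phi> x - \<phi> y\<bar> \<le> \<bar>x - y\<bar>"
  by (simp add: lip0_def)

lemma lip0_le: assumes "\<phi> \<in> lip0" shows "\<bar>\<phi> x\<bar> \<le> \<bar>x\<bar>"
  using lip0_diff[OF assms, of x 0] assms by (simp add: lip0_def)

lemma continuous_on_lip0:
  assumes "\<phi> \<in> lip0"
  shows "continuous_on S \<phi>"
proof -
  have "1-lipschitz_on S \<phi>"
    using lip0_diff[OF assms] by (auto simp: lipschitz_on_def dist_real_def)
  then show ?thesis by (rule lipschitz_on_continuous_on)
qed

lemma measurable_lip0 [measurable_dest]: "\<phi> \<in> lip0 \<Longrightarrow> \<phi> \<in> borel_measurable borel"
  by (intro borel_measurable_continuous_onI continuous_on_lip0)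

lemma space_pos_borel [simp]: "space pos_borel = {0<..}"
  by (simp add: space_restrict_space)

lemma measurable_ident_pos_borel [measurable]: "(\<lambda>x. x) \<in> measurable pos_borel borel"
  by (rule measurable_restrict_space1) simp

text \<open>The product measure is taken of spaces whose carrier is \<open>{0<..}\<close>, so a function continuous on the open
quadrant is first extended by 0 to a Borel function on the plane.\<close>

lemma measurable_pair_pos_borel:
  fixes F :: "real \<times> real \<Rightarrow> real"
  assumes "continuous_on ({0<..} \<times> {0<..}) F"
  shows "F \<in> borel_measurable (pos_borel \<Otimes>\<^sub>M pos_borel)"
proof -
  have "(\<lambda>x. indicator ({0<..} \<times> {0<..}) x *\<^sub>R F x) \<in> borel_measurable borel"
    by (rule borel_measurable_continuous_on_indicator[OF _ assms]) (auto intro!: borel_open open_Times)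
  then have m: "(\<lambda>x. indicator ({0<..} \<times> {0<..}) x *\<^sub>R F x) \<in> borel_measurable (borel \<Otimes>\<^sub>M borel)"
    by (simp add: borel_prod)
  have "(\<lambda>p. (fst p, snd p)) \<in> measurable (pos_borel \<Otimes>\<^sub>M pos_borel) (borel \<Otimes>\<^sub>M borel)"
    by (intro measurable_Pair measurable_compose[OF measurable_fst measurable_ident_pos_borel]
        measurable_compose[OF measurable_snd measurable_ident_pos_borel])
  from measurable_compose[OF this m]
  have "(\<lambda>p. indicator ({0<..} \<times> {0<..}) (fst p, snd p) *\<^sub>R F (fst p, snd p))
    \<in> borel_measurable (pos_borel \<Otimes>\<^sub>M pos_borel)" .
  then show ?thesis
    by (rule measurable_cong[THEN iffD1, rotated]) (auto simp: space_pair_measure)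
qed

text \<open>Positivity of an integral is obtained by comparing zero sets with those of a function \<open>\<phi>\<close> whose integral is
already known to be positive.\<close>

lemma integral_pos_if_pos_where:
  fixes F \<phi> :: "'a \<Rightarrow> real"
  assumes "integrable M F" "\<And>x. x \<in> space M \<Longrightarrow> 0 \<le> F x"
    and "\<And>x. x \<in> space M \<Longrightarrow> 0 \<le> \<phi> x"
    and "0 < (\<integral>x. \<phi> x \<partial>M)"
    and imp: "\<And>x. x \<in> space M \<Longrightarrow> 0 < \<phi> x \<Longrightarrow> 0 < F x"
  shows "0 < (\<integral>x. F x \<partial>M)"
proof (rule ccontr)
  assume "\<not> ?thesis"
  moreover have "0 \<le> (\<integral>x. F x \<partial>M)" using assms by (intro Bochner_Integration.integral_nonneg) auto
  ultimately have "(\<integral>x. F x \<partial>M) = 0" by simp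
  with assms have "AE x in M. F x = 0" by (subst (asm) integral_nonneg_eq_0_iff_AE) auto
  with AE_space have "AE x in M. \<phi> x = 0"
  proof eventually_elim
    case (elim x)
    with imp[of x] assms(3)[of x] show ?case by (cases "\<phi> x = 0") auto
  qed
  then have "(\<integral>x. \<phi> x \<partial>M) = 0" by (rule integral_eq_zero_AE)
  with assms show False by simp
qed

text \<open>The weight \<open>1 + v powr \<gamma>\<close> bounds the total mass, the first moment and the \<open>\<gamma>\<close>-moment at once, so a single
constant \<open>B\<close> suffices in all estimates below.\<close>

definition tame :: "real \<Rightarrow> real \<Rightarrow> real measure \<Rightarrow> bool" where
  "tame \<gamma> B \<mu> \<longleftrightarrow> sets \<mu> = sets pos_borel \<and> (\<integral>\<^sup>+v. ennreal (1 + v powr \<gamma>) \<partial>\<mu>) \<le> ennreal B"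

lemma le_one_plus_powr:
  fixes v \<gamma> :: real assumes "0 \<le> v" "1 \<le> \<gamma>" shows "v \<le> 1 + v powr \<gamma>"
proof (cases "v \<le> 1")
  case False
  then have "v powr 1 \<le> v powr \<gamma>" using assms by (intro powr_mono) auto
  with False show ?thesis by simp
qed (simp add: add_increasing2)

context
  fixes \<gamma> B :: real and \<mu> :: "real measure"
  assumes tame: "tame \<gamma> B \<mu>" and B: "0 \<le> B"
begin

lemma tame_sets [measurable_cong]: "sets \<mu> = sets pos_borel"
  using tame by (simp add: tame_def)

lemma tame_space: "space \<mu> = {0<..}"
  using sets_eq_imp_space_eq[OF tame_sets] by simp

lemma tame_measurable:
  "F \<in> borel_measurable pos_borel \<Longrightarrow> F \<in> borel_measurable \<mu>"
  by (simp cong: measurable_cong_sets add: tame_sets)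

lemma tame_integrable_weight: "integrable \<mu> (\<lambda>v. 1 + v powr \<gamma>)"
proof (rule integrableI_nonneg)
  show "(\<integral>\<^sup>+v. ennreal (1 + v powr \<gamma>) \<partial>\<mu>) < \<infinity>"
    using tame by (auto simp: tame_def intro: le_less_trans)
qed auto

lemma tame_integral_weight: "(\<integral>v. 1 + v powr \<gamma> \<partial>\<mu>) \<le> B"
proof -
  have "ennreal (\<integral>v. 1 + v powr \<gamma> \<partial>\<mu>) = (\<integral>\<^sup>+v. ennreal (1 + v powr \<gamma>) \<partial>\<mu>)"
    by (rule nn_integral_eq_integral[symmetric, OF tame_integrable_weight]) auto
  also have "\<dots> \<le> ennreal B" using tame by (simp add: tame_def)
  finally show ?thesis using B by (simp add: ennreal_le_iff)
qed

lemma tame_integrable: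
  fixes F :: "real \<Rightarrow> real"
  assumes "F \<in> borel_measurable pos_borel" "\<And>v. 0 < v \<Longrightarrow> \<bar>F v\<bar> \<le> c * (1 + v powr \<gamma>)"
  shows "integrable \<mu> F"
proof (rule Bochner_Integration.integrable_bound)
  show "integrable \<mu> (\<lambda>v. c * (1 + v powr \<gamma>))"
    using tame_integrable_weight by (rule integrable_mult_right)
  show "F \<in> borel_measurable \<mu>" by (rule tame_measurable[OF assms(1)])
  show "AE v in \<mu>. norm (F v) \<le> norm (c * (1 + v powr \<gamma>))"
    using assms(2) by (intro AE_I2) (force simp: tame_space)
qed

lemma tame_integral_le:
  fixes F :: "real \<Rightarrow> real"
  assumes "0 \<le> c" "\<And>v. 0 < v \<Longrightarrow> F v \<le> c * (1 + v powr \<gamma>)"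
  shows "(\<integral>v. F v \<partial>\<mu>) \<le> c * B"
proof (cases "integrable \<mu> F")
  case True
  then have "(\<integral>v. F v \<partial>\<mu>) \<le> (\<integral>v. c * (1 + v powr \<gamma>) \<partial>\<mu>)"
    using assms(2) tame_integrable_weight
    by (intro integral_mono integrable_mult_right) (auto simp: tame_space)
  also have "\<dots> = c * (\<integral>v. 1 + v powr \<gamma> \<partial>\<mu>)" by simp
  also have "\<dots> \<le> c * B" by (intro mult_left_mono tame_integral_weight assms)
  finally show ?thesis .
qed (use assms B in \<open>simp add: not_integrable_integral_eq\<close>)

lemma tame_integral_abs_le:
  fixes F :: "real \<Rightarrow> real"
  assumes "0 \<le> c" "\<And>v. 0 < v \<Longrightarrow> \<bar>F v\<bar> \<le> c * (1 + v powr \<gamma>)"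
  shows "\<bar>\<integral>v. F v \<partial>\<mu>\<bar> \<le> c * B"
proof -
  have "\<bar>\<integral>v. F v \<partial>\<mu>\<bar> \<le> (\<integral>v. \<bar>F v\<bar> \<partial>\<mu>)" by simp
  also have "\<dots> \<le> c * B" using assms by (rule tame_integral_le)
  finally show ?thesis .
qed

lemma tame_emeasure_le: "emeasure \<mu> A \<le> ennreal B"
proof -
  have "emeasure \<mu> A \<le> emeasure \<mu> (space \<mu>)" by (rule emeasure_space)
  also have "\<dots> = (\<integral>\<^sup>+v. 1 \<partial>\<mu>)" by simp
  also have "\<dots> \<le> (\<integral>\<^sup>+v. ennreal (1 + v powr \<gamma>) \<partial>\<mu>)"
    by (intro nn_integral_mono) (simp add: ennreal_leI flip: ennreal_1)
  also have "\<dots> \<le> ennreal B" using tame by (simp add: tame_def)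
  finally show ?thesis .
qed

lemma tame_sigma_finite: "sigma_finite_measure \<mu>"
proof -
  have "emeasure \<mu> (space \<mu>) \<le> ennreal B" by (rule tame_emeasure_le)
  also have "\<dots> < \<infinity>" by simp
  finally have "finite_measure \<mu>" by (intro finite_measureI) auto
  then show ?thesis by (rule finite_measure.axioms)
qed

end

text \<open>The product weight is what makes both iterated integrals of \<open>F\<close> against a tame measure converge, with the
bound \<open>c * B * B\<close> that does not depend on the measure.\<close>

definition dominated :: "real \<Rightarrow> real \<Rightarrow> (real \<Rightarrow> real \<Rightarrow> real) \<Rightarrow> bool" where
  "dominated \<gamma> c F \<longleftrightarrow> 0 \<le> c \<and> case_prod F \<in> borel_measurable (pos_borel \<Otimes>\<^sub>M pos_borel) \<and>
     (\<forall>v>0. \<forall>w>0. \<bar>F v w\<bar> \<le> c * (1 + v powr \<gamma>) * (1 + w powr \<gamma>))"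

text \<open>The inner integration variable is the first argument; this is the order in which the weak formulation
integrates the kernel.\<close>

definition dint :: "real measure \<Rightarrow> (real \<Rightarrow> real \<Rightarrow> real) \<Rightarrow> real" where
  "dint \<mu> F = (\<integral>w. (\<integral>v. F v w \<partial>\<mu>) \<partial>\<mu>)"

context
  fixes \<gamma> B :: real and \<mu> :: "real measure"
  assumes tame: "tame \<gamma> B \<mu>" and B: "0 \<le> B"
begin

lemma dominated_measurable1:
  assumes "dominated \<gamma> c F" "0 < w"
  shows "(\<lambda>v. F v w) \<in> borel_measurable pos_borel"
proof -
  have "(\<lambda>v. (v, w)) \<in> measurable pos_borel (pos_borel \<Otimes>\<^sub>M pos_borel)"
    using assms by (intro measurable_Pair) auto
  from measurable_compose[OF this, of "case_prod F" borel] assms(1) show ?thesis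
    by (simp add: dominated_def)
qed

lemma dominated_bound1:
  assumes "dominated \<gamma> c F" "0 < w" "0 < v"
  shows "\<bar>F v w\<bar> \<le> (c * (1 + w powr \<gamma>)) * (1 + v powr \<gamma>)"
  using assms by (simp add: dominated_def mult_ac)

lemma dominated_integrable1:
  assumes "dominated \<gamma> c F" "0 < w"
  shows "integrable \<mu> (\<lambda>v. F v w)"
  by (rule tame_integrable[OF tame B dominated_measurable1[OF assms] dominated_bound1[OF assms]])

lemma dominated_bound2:
  assumes "dominated \<gamma> c F" "0 < w"
  shows "\<bar>\<integral>v. F v w \<partial>\<mu>\<bar> \<le> (c * B) * (1 + w powr \<gamma>)"
proof -
  have "\<bar>\<integral>v. F v w \<partial>\<mu>\<bar> \<le> (c * (1 + w powr \<gamma>)) * B"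
    using assms by (intro tame_integral_abs_le[OF tame B] dominated_bound1)
      (auto simp: dominated_def)
  then show ?thesis by (simp add: mult_ac)
qed

lemma dominated_measurable2:
  assumes "dominated \<gamma> c F"
  shows "(\<lambda>w. \<integral>v. F v w \<partial>\<mu>) \<in> borel_measurable pos_borel"
proof -
  interpret sigma_finite_measure \<mu> by (rule tame_sigma_finite[OF tame B])
  have "case_prod F \<in> borel_measurable (\<mu> \<Otimes>\<^sub>M pos_borel)"
    using assms unfolding dominated_def
    by (simp cong: measurable_cong_sets sets_pair_measure_cong add: tame_sets[OF tame B])
  then have "(\<lambda>(w, v). F v w) \<in> borel_measurable (pos_borel \<Otimes>\<^sub>M \<mu>)"
    by (subst measurable_pair_swap_iff) simp
  from borel_measurable_lebesgue_integral[OF this] show ?thesis by simp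
qed

lemma dominated_integrable2:
  assumes "dominated \<gamma> c F"
  shows "integrable \<mu> (\<lambda>w. \<integral>v. F v w \<partial>\<mu>)"
  by (rule tame_integrable[OF tame B dominated_measurable2[OF assms] dominated_bound2[OF assms]])

lemma dint_bound:
  assumes "dominated \<gamma> c F"
  shows "\<bar>dint \<mu> F\<bar> \<le> c * B * B"
  unfolding dint_def using assms B
  by (intro tame_integral_abs_le[OF tame B] dominated_bound2) (auto simp: dominated_def)

lemma dint_mono:
  assumes F: "dominated \<gamma> c F" and G: "dominated \<gamma> d G"
    and le: "\<And>v w. 0 < v \<Longrightarrow> 0 < w \<Longrightarrow> F v w \<le> G v w"
  shows "dint \<mu> F \<le> dint \<mu> G"
  unfolding dint_def
  by (intro integral_mono dominated_integrable1[OF F] dominated_integrable1[OF G]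
      dominated_integrable2[OF F] dominated_integrable2[OF G] le)
    (auto simp: tame_space[OF tame B])

lemma dint_add:
  assumes F: "dominated \<gamma> c F" and G: "dominated \<gamma> d G"
  shows "dint \<mu> (\<lambda>v w. F v w + G v w) = dint \<mu> F + dint \<mu> G"
proof -
  have "dint \<mu> (\<lambda>v w. F v w + G v w) = (\<integral>w. (\<integral>v. F v w \<partial>\<mu>) + (\<integral>v. G v w \<partial>\<mu>) \<partial>\<mu>)"
    unfolding dint_def
    by (intro Bochner_Integration.integral_cong refl Bochner_Integration.integral_add
        dominated_integrable1[OF F] dominated_integrable1[OF G])
      (auto simp: tame_space[OF tame B])
  also have "\<dots> = dint \<mu> F + dint \<mu> G" unfolding dint_def
    by (intro Bochner_Integration.integral_add dominated_integrable2[OF F] dominated_integrable2[OF G])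
  finally show ?thesis .
qed

lemma dint_tendsto:
  assumes F: "\<And>i. dominated \<gamma> c (F i)" and G: "dominated \<gamma> d G"
    and lim: "\<And>v w. 0 < v \<Longrightarrow> 0 < w \<Longrightarrow> (\<lambda>i. F i v w) \<longlonglongrightarrow> G v w"
  shows "(\<lambda>i. dint \<mu> (F i)) \<longlonglongrightarrow> dint \<mu> G"
proof -
  note W = tame_integrable_weight[OF tame B]
  have inner: "(\<lambda>i. \<integral>v. F i v w \<partial>\<mu>) \<longlonglongrightarrow> (\<integral>v. G v w \<partial>\<mu>)" if "0 < w" for w
  proof (rule integral_dominated_convergence)
    show "(\<lambda>v. G v w) \<in> borel_measurable \<mu>"
      by (rule tame_measurable[OF tame B dominated_measurable1[OF G that]])
    show "(\<lambda>v. F i v w) \<in> borel_measurable \<mu>" for i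
      by (rule tame_measurable[OF tame B dominated_measurable1[OF F that]])
    show "integrable \<mu> (\<lambda>v. (c * (1 + w powr \<gamma>)) * (1 + v powr \<gamma>))"
      using W by (rule integrable_mult_right)
    show "AE v in \<mu>. (\<lambda>i. F i v w) \<longlonglongrightarrow> G v w"
      using lim that by (intro AE_I2) (auto simp: tame_space[OF tame B])
    show "AE v in \<mu>. norm (F i v w) \<le> (c * (1 + w powr \<gamma>)) * (1 + v powr \<gamma>)" for i
      using dominated_bound1[OF F that] by (intro AE_I2) (auto simp: tame_space[OF tame B])
  qed
  show ?thesis unfolding dint_def
  proof (rule integral_dominated_convergence)
    show "(\<lambda>w. \<integral>v. G v w \<partial>\<mu>) \<in> borel_measurable \<mu>"
      by (rule tame_measurable[OF tame B dominated_measurable2[OF G]])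
    show "(\<lambda>w. \<integral>v. F i v w \<partial>\<mu>) \<in> borel_measurable \<mu>" for i
      by (rule tame_measurable[OF tame B dominated_measurable2[OF F]])
    show "integrable \<mu> (\<lambda>w. (c * B) * (1 + w powr \<gamma>))"
      using W by (rule integrable_mult_right)
    show "AE w in \<mu>. (\<lambda>i. \<integral>v. F i v w \<partial>\<mu>) \<longlonglongrightarrow> (\<integral>v. G v w \<partial>\<mu>)"
      using inner by (intro AE_I2) (auto simp: tame_space[OF tame B])
    show "AE w in \<mu>. norm (\<integral>v. F i v w \<partial>\<mu>) \<le> (c * B) * (1 + w powr \<gamma>)" for i
      using dominated_bound2[OF F] by (intro AE_I2) (auto simp: tame_space[OF tame B])
  qed
qed

lemma dint_pos:
  fixes \<phi> \<theta> :: "real \<Rightarrow> real"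
  assumes F: "dominated \<gamma> c F" and nonneg: "\<And>v w. 0 < v \<Longrightarrow> 0 < w \<Longrightarrow> 0 \<le> F v w"
    and \<phi>: "\<And>v. 0 < v \<Longrightarrow> 0 \<le> \<phi> v" "0 < (\<integral>v. \<phi> v \<partial>\<mu>)"
    and \<theta>: "\<And>w. 0 < w \<Longrightarrow> 0 \<le> \<theta> w" "0 < (\<integral>w. \<theta> w \<partial>\<mu>)"
    and pos: "\<And>v w. 0 < v \<Longrightarrow> 0 < w \<Longrightarrow> 0 < \<phi> v \<Longrightarrow> 0 < \<theta> w \<Longrightarrow> 0 < F v w"
  shows "0 < dint \<mu> F"
  unfolding dint_def
proof (rule integral_pos_if_pos_where[OF dominated_integrable2[OF F]])
  show "0 < (\<integral>w. \<theta> w \<partial>\<mu>)" by (rule \<theta>)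
  fix w assume "w \<in> space \<mu>"
  then have w: "0 < w" by (simp add: tame_space[OF tame B])
  show "0 \<le> (\<integral>v. F v w \<partial>\<mu>)"
    using nonneg w by (intro Bochner_Integration.integral_nonneg) (auto simp: tame_space[OF tame B])
  show "0 \<le> \<theta> w" using \<theta> w by simp
  assume "0 < \<theta> w"
  then show "0 < (\<integral>v. F v w \<partial>\<mu>)" using w
    by (intro integral_pos_if_pos_where[OF dominated_integrable1[OF F w] _ _ \<phi>(2)] nonneg \<phi>(1) pos)
      (auto simp: tame_space[OF tame B])
qed

end

section \<open>Measurability along a flow of measures\<close>

text \<open>Integrals against a measurable kernel of subprobability measures depend measurably on the parameter. A family of measures of total mass at most \<open>B\<close> is reduced to this case by scaling with \<open>1 / B\<close>, and
a signed integrand is split into its positive and negative part.\<close>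

lemma measurable_integral_scaled_kernel:
  fixes F :: "'a \<Rightarrow> 'b \<Rightarrow> real"
  assumes L: "(\<lambda>x. scale_measure (ennreal (1 / B)) (g x)) \<in> measurable N (subprob_algebra P)"
    and "0 < B"
    and F: "case_prod F \<in> borel_measurable (N \<Otimes>\<^sub>M P)"
    and int: "\<And>x. x \<in> space N \<Longrightarrow> integrable (g x) (F x)"
  shows "(\<lambda>x. \<integral>v. F x v \<partial>g x) \<in> borel_measurable N"
proof -
  have sets: "sets (g x) = sets P" if "x \<in> space N" for x
    using measurable_space[OF L that] by (simp add: space_subprob_algebra)
  have nn: "(\<lambda>x. \<integral>\<^sup>+v. ennreal (G x v) \<partial>g x) \<in> borel_measurable N"
    if G: "case_prod G \<in> borel_measurable (N \<Otimes>\<^sub>M P)" for G :: "'a \<Rightarrow> 'b \<Rightarrow> real"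
  proof -
    have Ge: "(\<lambda>(x, v). ennreal (G x v)) \<in> borel_measurable (N \<Otimes>\<^sub>M P)"
      using G by (simp add: case_prod_unfold)
    have "(\<lambda>x. ennreal B * (\<integral>\<^sup>+v. ennreal (G x v) \<partial>scale_measure (ennreal (1 / B)) (g x)))
        \<in> borel_measurable N"
      by (intro borel_measurable_times_ennreal borel_measurable_const
          nn_integral_measurable_subprob_algebra2[OF Ge L])
    moreover have "ennreal B * (\<integral>\<^sup>+v. ennreal (G x v) \<partial>scale_measure (ennreal (1 / B)) (g x))
        = (\<integral>\<^sup>+v. ennreal (G x v) \<partial>g x)" if "x \<in> space N" for x
    proof -
      have "(\<lambda>v. ennreal (G x v)) \<in> borel_measurable P"
        using measurable_compose[OF measurable_Pair1'[OF that, of P] Ge] by simp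
      then have "(\<lambda>v. ennreal (G x v)) \<in> borel_measurable (g x)"
        using sets[OF that] by (simp cong: measurable_cong_sets)
      moreover have "ennreal B * ennreal (1 / B) = 1"
        using \<open>0 < B\<close> by (simp flip: ennreal_mult)
      ultimately show ?thesis
        by (simp add: nn_integral_scale_measure flip: mult.assoc)
    qed
    ultimately show ?thesis by (simp cong: measurable_cong)
  qed
  have "(\<lambda>x. enn2real (\<integral>\<^sup>+v. ennreal (F x v) \<partial>g x) - enn2real (\<integral>\<^sup>+v. ennreal (- F x v) \<partial>g x))
      \<in> borel_measurable N"
    using F by (intro borel_measurable_diff measurable_compose[OF nn borel_measurable_enn2real])
      (auto simp: case_prod_unfold)
  then show ?thesis
    by (rule measurable_cong[THEN iffD1, rotated]) (simp add: real_lebesgue_integral_def int)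
qed

text \<open>Half-lines are stable under intersection, so a family of finite measures on \<open>{0<..}\<close> is determined, also with regard
to measurability in a parameter, by its values on them.\<close>

lemma sets_pos_borel_generated:
  "sets pos_borel = sigma_sets {0<..} ((\<lambda>a. {max 0 a<..}) ` UNIV)"
proof -
  have "sets pos_borel = (\<inter>) {0<..} ` sigma_sets UNIV (range greaterThan)"
    unfolding sets_restrict_space by (subst borel_Ioi) simp
  also have "\<dots> = sigma_sets {0<..} ((\<inter>) {0<..} ` range greaterThan)"
    by (rule sigma_sets_Int) (auto simp flip: borel_Ioi sets_measure_of)
  also have "(\<inter>) {0<..} ` range greaterThan = range (\<lambda>a::real. {max 0 a<..})"
    by (auto simp: image_image greaterThan_Int_greaterThan)
  finally show ?thesis .
qed

text \<open>The functions \<open>\<phi> i\<close> are continuous and vanish outside \<open>{a + 1 / (i + 1)..i}\<close>, a compact subset of the open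
half-line even for \<open>a = 0\<close>, and they converge pointwise to the indicator of \<open>{a<..}\<close>. So masses of half-lines are
limits of quantities that the vague topology controls.\<close>

lemma tame_tail_LIMSEQ:
  assumes tame: "tame \<gamma> B \<mu>" and B: "0 \<le> B" and "0 \<le> a"
  defines "\<phi> \<equiv> \<lambda>(i::nat) v. min 1 (real i * max 0 (min (v - a - 1 / (real i + 1)) (real i - v)))"
  shows "(\<lambda>i. \<integral>v. \<phi> i v \<partial>\<mu>) \<longlonglongrightarrow> measure \<mu> {a<..}"
proof -
  have lim: "(\<lambda>i. \<phi> i v) \<longlonglongrightarrow> indicator {a<..} v" for v
  proof (cases "a < v")
    case True
    have "\<forall>\<^sub>F i in sequentially. real i \<ge> v + 1 + 2 / (v - a)"
      using filterlim_real_sequentially by (simp add: filterlim_at_top)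
    then have "\<forall>\<^sub>F i in sequentially. \<phi> i v = 1"
    proof eventually_elim
      case (elim i)
      have pos: "0 < 2 / (v - a)" using True by simp
      then have i: "1 \<le> real i" "2 / (v - a) \<le> real i" "1 \<le> real i - v"
        using elim True \<open>0 \<le> a\<close> by linarith+
      have "2 \<le> real i * (v - a)" using i(2) True by (simp add: field_simps)
      moreover have "real i * (1 / (real i + 1)) \<le> 1" using i by simp
      ultimately have "1 \<le> real i * (v - a - 1 / (real i + 1))"
        unfolding right_diff_distrib by linarith
      moreover have "1 * 1 \<le> real i * (real i - v)" using i by (intro mult_mono) auto
      ultimately have "1 \<le> real i * min (v - a - 1 / (real i + 1)) (real i - v)"
        by (auto simp: min_def)
      also have "\<dots> \<le> real i * max 0 (min (v - a - 1 / (real i + 1)) (real i - v))"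
        by (intro mult_left_mono) auto
      finally show ?case by (simp add: \<phi>_def)
    qed
    then show ?thesis using True by (simp add: tendsto_eventually)
  next
    case False
    have "\<phi> i v = 0" for i
    proof -
      have "0 \<le> 1 / (real i + 1)" by simp
      with False have "min (v - a - 1 / (real i + 1)) (real i - v) \<le> 0"
        unfolding min_le_iff_disj by linarith
      then show ?thesis by (simp add: \<phi>_def)
    qed
    then show ?thesis using False by simp
  qed
  have "(\<lambda>i. \<integral>v. \<phi> i v \<partial>\<mu>) \<longlonglongrightarrow> (\<integral>v. indicator {a<..} v \<partial>\<mu>)"
  proof (rule integral_dominated_convergence)
    show "integrable \<mu> (\<lambda>v. 1 + v powr \<gamma>)" by (rule tame_integrable_weight[OF tame B])
    show "(\<lambda>v. indicator {a<..} v :: real) \<in> borel_measurable \<mu>"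
      by (rule tame_measurable[OF tame B]) measurable
    show "\<phi> i \<in> borel_measurable \<mu>" for i
      unfolding \<phi>_def by (rule tame_measurable[OF tame B]) measurable
    show "AE v in \<mu>. norm (\<phi> i v) \<le> 1 + v powr \<gamma>" for i
    proof (rule AE_I2)
      fix v
      have "\<bar>\<phi> i v\<bar> \<le> 1" by (auto simp: \<phi>_def abs_le_iff min_def)
      then show "norm (\<phi> i v) \<le> 1 + v powr \<gamma>" by (simp add: add_increasing2)
    qed
  qed (use lim in auto)
  moreover have "{a<..} \<inter> space \<mu> = {a<..}"
    using \<open>0 \<le> a\<close> by (auto simp: tame_space[OF tame B])
  ultimately show ?thesis by simp
qed

text \<open>A vaguely continuous family is a measurable kernel: masses of half-lines are measurable in time as limits of
continuous functions, and half-lines generate the Borel sets.\<close>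

lemma measurable_scaled_flow:
  fixes T :: real
  assumes tame: "\<And>s. s \<in> {0..T} \<Longrightarrow> tame \<gamma> B (f s)" and B: "0 < B"
    and cont: "\<And>\<phi>. \<phi> \<in> Cc_pos \<Longrightarrow> continuous_on {0..T} (\<lambda>s. \<integral>v. \<phi> v \<partial>f s)"
  shows "(\<lambda>s. scale_measure (ennreal (1 / B)) (f s))
    \<in> measurable (restrict_space borel {0..T}) (subprob_algebra pos_borel)"
proof (rule measurable_subprob_algebra_generated[OF sets_pos_borel_generated])
  have B': "0 \<le> B" using B by simp
  have tail: "(\<lambda>s. emeasure (f s) {a<..}) \<in> borel_measurable (restrict_space borel {0..T})"
    if a: "0 \<le> a" for a
  proof -
    define \<phi> where "\<phi> i v = min 1 (real i * max 0 (min (v - a - 1 / (real i + 1)) (real i - v)))"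
      for i :: nat and v
    have "\<phi> i \<in> Cc_pos" for i
      unfolding Cc_pos_def
    proof (intro CollectI conjI exI[of _ "{a + 1 / (real i + 1)..real i}"] ballI)
      show "continuous_on {0<..} (\<phi> i)" unfolding \<phi>_def by (intro continuous_intros)
      have "0 < a + 1 / (real i + 1)" using a by (intro add_nonneg_pos) auto
      then show "{a + 1 / (real i + 1)..real i} \<subseteq> {0<..}" by (auto intro: less_le_trans)
      fix v assume "v \<in> {0<..} - {a + 1 / (real i + 1)..real i}"
      then have "v < a + 1 / (real i + 1) \<or> real i < v" by auto
      then have "min (v - a - 1 / (real i + 1)) (real i - v) \<le> 0"
        unfolding min_le_iff_disj by linarith
      then show "\<phi> i v = 0" by (simp add: \<phi>_def)
    qed auto
    then have "(\<lambda>s. \<integral>v. \<phi> i v \<partial>f s) \<in> borel_measurable (restrict_space borel {0..T})" for i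
      by (intro borel_measurable_continuous_on_restrict cont)
    moreover have "(\<lambda>i. \<integral>v. \<phi> i v \<partial>f s) \<longlonglongrightarrow> measure (f s) {a<..}" if "s \<in> {0..T}" for s
      unfolding \<phi>_def by (rule tame_tail_LIMSEQ[OF tame[OF that] B' a])
    ultimately have "(\<lambda>s. measure (f s) {a<..}) \<in> borel_measurable (restrict_space borel {0..T})"
      by (rule borel_measurable_LIMSEQ_real[where u = "\<lambda>i s. \<integral>v. \<phi> i v \<partial>f s", rotated])
        (simp add: space_restrict_space)
    then have "(\<lambda>s. ennreal (measure (f s) {a<..})) \<in> borel_measurable (restrict_space borel {0..T})"
      by simp
    moreover have "ennreal (measure (f s) {a<..}) = emeasure (f s) {a<..}" if "s \<in> {0..T}" for s
    proof -
      have "emeasure (f s) {a<..} \<le> ennreal B" by (rule tame_emeasure_le[OF tame[OF that] B'])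
      then have "emeasure (f s) {a<..} \<noteq> \<top>" by (auto simp: top_unique)
      then show ?thesis by (simp add: emeasure_eq_ennreal_measure)
    qed
    ultimately show ?thesis
      by (rule measurable_cong[THEN iffD1, rotated]) (auto simp: space_restrict_space)
  qed
  show "Int_stable (range (\<lambda>a. {max 0 a<..} :: real set))"
  proof (rule Int_stableI_image)
    fix a b :: real
    show "\<exists>c\<in>UNIV. {max 0 a<..} \<inter> {max 0 b<..} = {max 0 c<..}"
      by (intro bexI[of _ "max a b"]) auto
  qed
  show "range (\<lambda>a. {max 0 a<..}) \<subseteq> Pow {0::real<..}" by auto
  show "sets (scale_measure (ennreal (1 / B)) (f s)) = sets pos_borel"
    if "s \<in> space (restrict_space borel {0..T})" for s
    using tame[of s] that by (simp add: tame_def space_restrict_space)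
  show "subprob_space (scale_measure (ennreal (1 / B)) (f s))"
    if "s \<in> space (restrict_space borel {0..T})" for s
  proof (rule subprob_spaceI)
    have s: "s \<in> {0..T}" using that by (simp add: space_restrict_space)
    have "emeasure (scale_measure (ennreal (1 / B)) (f s)) (space (f s)) \<le> ennreal (1 / B) * ennreal B"
      by (simp add: mult_left_mono tame_emeasure_le[OF tame[OF s] B'])
    also have "\<dots> = 1" using B by (simp flip: ennreal_mult)
    finally show "emeasure (scale_measure (ennreal (1 / B)) (f s))
        (space (scale_measure (ennreal (1 / B)) (f s))) \<le> 1" by (simp add: space_scale_measure)
    show "space (scale_measure (ennreal (1 / B)) (f s)) \<noteq> {}"
      by (simp add: space_scale_measure tame_space[OF tame[OF s] B'])
  qed
  show "(\<lambda>s. emeasure (scale_measure (ennreal (1 / B)) (f s)) X)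
      \<in> borel_measurable (restrict_space borel {0..T})"
    if "X \<in> range (\<lambda>a. {max 0 a<..})" for X
    using that tail by auto
  show "(\<lambda>s. emeasure (scale_measure (ennreal (1 / B)) (f s)) {0<..})
      \<in> borel_measurable (restrict_space borel {0..T})"
    using tail[of 0] by simp
qed

text \<open>Without this measurability the time integral in the weak formulation would carry no information, as the
Bochner integral of a non-measurable function is 0.\<close>

lemma measurable_dint_flow:
  fixes T :: real
  assumes tame: "\<And>s. s \<in> {0..T} \<Longrightarrow> tame \<gamma> B (f s)" and B: "0 < B"
    and cont: "\<And>\<phi>. \<phi> \<in> Cc_pos \<Longrightarrow> continuous_on {0..T} (\<lambda>s. \<integral>v. \<phi> v \<partial>f s)"
    and F: "dominated \<gamma> c F"
  shows "(\<lambda>s. dint (f s) F) \<in> borel_measurable (restrict_space borel {0..T})"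
proof -
  let ?M = "restrict_space borel {0..T} :: real measure"
  have B': "0 \<le> B" using B by simp
  have L: "(\<lambda>s. scale_measure (ennreal (1 / B)) (f s)) \<in> measurable ?M (subprob_algebra pos_borel)"
    by (rule measurable_scaled_flow[OF tame B cont])
  have F': "case_prod F \<in> borel_measurable (pos_borel \<Otimes>\<^sub>M pos_borel)"
    using F by (simp add: dominated_def)
  have inner: "(\<lambda>x. \<integral>v. F v (snd x) \<partial>f (fst x)) \<in> borel_measurable (?M \<Otimes>\<^sub>M pos_borel)"
  proof (rule measurable_integral_scaled_kernel[OF _ B])
    show "(\<lambda>x. scale_measure (ennreal (1 / B)) (f (fst x)))
        \<in> measurable (?M \<Otimes>\<^sub>M pos_borel) (subprob_algebra pos_borel)"
      by (rule measurable_compose[OF measurable_fst L])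
    have "(\<lambda>p. (snd p, snd (fst p))) \<in> measurable ((?M \<Otimes>\<^sub>M pos_borel) \<Otimes>\<^sub>M pos_borel) (pos_borel \<Otimes>\<^sub>M pos_borel)"
      by measurable
    from measurable_compose[OF this F']
    show "(\<lambda>(x, v). F v (snd x)) \<in> borel_measurable ((?M \<Otimes>\<^sub>M pos_borel) \<Otimes>\<^sub>M pos_borel)"
      by (simp add: case_prod_unfold)
    show "integrable (f (fst x)) (\<lambda>v. F v (snd x))" if "x \<in> space (?M \<Otimes>\<^sub>M pos_borel)" for x
      using that by (intro dominated_integrable1[OF tame B' F]) (auto simp: space_pair_measure space_restrict_space)
  qed
  show ?thesis unfolding dint_def
  proof (rule measurable_integral_scaled_kernel[OF L B])
    show "(\<lambda>(s, w). \<integral>v. F v w \<partial>f s) \<in> borel_measurable (?M \<Otimes>\<^sub>M pos_borel)"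
      using inner by (simp add: case_prod_unfold)
    show "integrable (f s) (\<lambda>w. \<integral>v. F v w \<partial>f s)" if "s \<in> space ?M" for s
      using that by (intro dominated_integrable2[OF tame B' F]) (auto simp: space_restrict_space)
  qed
qed

section \<open>Test functions and the collision kernel\<close>

lemma dominated_add:
  assumes F: "dominated \<gamma> c F" and G: "dominated \<gamma> d G"
  shows "dominated \<gamma> (c + d) (\<lambda>v w. F v w + G v w)"
  unfolding dominated_def
proof (intro conjI allI impI)
  show "(\<lambda>(v, w). F v w + G v w) \<in> borel_measurable (pos_borel \<Otimes>\<^sub>M pos_borel)"
    using F G by (auto simp: dominated_def case_prod_unfold intro!: borel_measurable_add)
  fix v w :: real assume vw: "0 < v" "0 < w"
  have "\<bar>F v w + G v w\<bar> \<le> \<bar>F v w\<bar> + \<bar>G v w\<bar>" by simp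
  also have "\<dots> \<le> c * (1 + v powr \<gamma>) * (1 + w powr \<gamma>) + d * (1 + v powr \<gamma>) * (1 + w powr \<gamma>)"
    using F G vw unfolding dominated_def by (intro add_mono) auto
  finally show "\<bar>F v w + G v w\<bar> \<le> (c + d) * (1 + v powr \<gamma>) * (1 + w powr \<gamma>)"
    by (simp add: distrib_right)
qed (use F G in \<open>auto simp: dominated_def\<close>)

definition bump :: "real \<Rightarrow> real \<Rightarrow> real \<Rightarrow> real" where
  "bump x e v = max 0 (e - \<bar>v - x\<bar>)"

lemma bump_nonneg [simp]: "0 \<le> bump x e v"
  by (simp add: bump_def)

lemma bump_pos_iff: "0 < bump x e v \<longleftrightarrow> \<bar>v - x\<bar> < e"
  by (auto simp: bump_def)

lemma bump_lip0: "e \<le> x \<Longrightarrow> bump x e \<in> lip0"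
  by (auto simp: lip0_def bump_def max_def)

lemma continuous_on_bump [continuous_intros]: "continuous_on S (bump x e)"
  unfolding bump_def by (intro continuous_intros)

lemma bump_Cc_pos: assumes "e < x" shows "bump x e \<in> Cc_pos"
  unfolding Cc_pos_def
  using assms by (intro CollectI conjI exI[of _ "{x - e..x + e}"] continuous_intros)
    (auto simp: bump_def)

definition tail :: "real \<Rightarrow> real \<Rightarrow> real" where
  "tail n v = max 0 (v - n)"

lemma tail_nonneg [simp]: "0 \<le> tail n v"
  by (simp add: tail_def)

lemma tail_lip0: "0 \<le> n \<Longrightarrow> tail n \<in> lip0"
  by (auto simp: lip0_def tail_def max_def)

text \<open>The tail function \<open>tail n\<close> does not have compact support. Letting it come down again with slope \<open>-1\<close> gives
test functions that have the same Lipschitz constant for every \<open>R\<close>, hence one common bound for their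
collision terms.\<close>

definition truncated_tail :: "real \<Rightarrow> real \<Rightarrow> real \<Rightarrow> real" where
  "truncated_tail n R v = max 0 (min (v - n) (R - v))"

lemma truncated_tail_lip0: "0 \<le> n \<Longrightarrow> truncated_tail n R \<in> lip0"
  by (simp add: lip0_def truncated_tail_def) linarith

lemma truncated_tail_Cc_pos: "0 < n \<Longrightarrow> truncated_tail n R \<in> Cc_pos"
  unfolding Cc_pos_def
  by (intro CollectI conjI exI[of _ "{n..R}"])
    (auto simp: truncated_tail_def intro!: continuous_intros)

lemma truncated_tail_LIMSEQ: "(\<lambda>i. truncated_tail n (real i) v) \<longlonglongrightarrow> tail n v"
proof -
  have "\<forall>\<^sub>F i in sequentially. real i \<ge> 2 * v - n"
    using filterlim_real_sequentially by (simp add: filterlim_at_top)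
  then have "\<forall>\<^sub>F i in sequentially. truncated_tail n (real i) v = tail n v"
    by eventually_elim (simp add: truncated_tail_def tail_def)
  then show ?thesis by (rule tendsto_eventually)
qed

text \<open>The properties of the kernel that drive the argument: growth of order at most \<open>\<gamma>\<close>, positivity off the
diagonal, and a lower bound of the same order \<open>\<gamma>\<close> for collisions of a large with a small particle, which are far from the diagonal.\<close>

locale off_diagonal_kernel =
  fixes \<gamma> A :: real and K :: "real \<Rightarrow> real \<Rightarrow> real"
  assumes \<gamma>: "1 < \<gamma>" and A: "0 \<le> A"
    and K_nonneg: "\<And>v w. 0 < v \<Longrightarrow> 0 < w \<Longrightarrow> 0 \<le> K v w"
    and K_le: "\<And>v w. 0 < v \<Longrightarrow> 0 < w \<Longrightarrow> K v w \<le> A * (v powr \<gamma> + w powr \<gamma>)"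
    and K_cont: "continuous_on ({0<..} \<times> {0<..}) (case_prod K)"
    and K_pos: "\<And>v w. 0 < v \<Longrightarrow> 0 < w \<Longrightarrow> v \<noteq> w \<Longrightarrow> 0 < K v w"
    and K_large: "\<And>b. 0 < b \<Longrightarrow>
      \<exists>N>0. \<exists>\<kappa>>0. \<forall>v\<ge>N. \<forall>w. 0 < w \<and> w \<le> b \<longrightarrow> \<kappa> * v powr \<gamma> \<le> K v w"
begin

definition collision :: "(real \<Rightarrow> real) \<Rightarrow> real \<Rightarrow> real \<Rightarrow> real" where
  "collision \<phi> v w = K v w * (\<phi> (v + w) - \<phi> v - \<phi> w)"

lemma powr_sum_le_product: "v powr \<gamma> + w powr \<gamma> \<le> (1 + v powr \<gamma>) * (1 + w powr \<gamma>)"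
  by (simp add: algebra_simps)

lemma K_le_product:
  assumes "0 < v" "0 < w"
  shows "K v w \<le> A * ((1 + v powr \<gamma>) * (1 + w powr \<gamma>))"
  using K_le[OF assms] mult_left_mono[OF powr_sum_le_product A] by (rule order_trans)

lemma dominated_kernel_mult:
  assumes G: "continuous_on UNIV (case_prod G)" and "0 \<le> c"
    and le: "\<And>v w. 0 < v \<Longrightarrow> 0 < w \<Longrightarrow> \<bar>G v w\<bar> \<le> c"
  shows "dominated \<gamma> (A * c) (\<lambda>v w. K v w * G v w)"
  unfolding dominated_def
proof (intro conjI allI impI)
  show "(\<lambda>(v, w). K v w * G v w) \<in> borel_measurable (pos_borel \<Otimes>\<^sub>M pos_borel)"
    using continuous_on_mult[OF K_cont continuous_on_subset[OF G subset_UNIV]]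
    by (intro measurable_pair_pos_borel) (simp add: case_prod_unfold)
  fix v w :: real assume vw: "0 < v" "0 < w"
  have "\<bar>K v w * G v w\<bar> = K v w * \<bar>G v w\<bar>" using K_nonneg[OF vw] by (simp add: abs_mult)
  also have "\<dots> \<le> (A * ((1 + v powr \<gamma>) * (1 + w powr \<gamma>))) * c"
    using vw A by (intro mult_mono K_le_product le) (auto intro!: mult_nonneg_nonneg)
  finally show "\<bar>K v w * G v w\<bar> \<le> A * c * (1 + v powr \<gamma>) * (1 + w powr \<gamma>)" by (simp add: mult_ac)
qed (use A assms in auto)

lemma dominated_collision:
  assumes \<phi>: "\<phi> \<in> lip0"
  shows "dominated \<gamma> (4 * A) (collision \<phi>)"
  unfolding dominated_def
proof (intro conjI allI impI)
  have "continuous_on UNIV (\<lambda>(v, w). \<phi> (v + w) - \<phi> v - \<phi> w)"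
    unfolding case_prod_unfold
    by (intro continuous_intros continuous_on_compose2[OF continuous_on_lip0[OF \<phi>, of UNIV]]) auto
  then show "case_prod (collision \<phi>) \<in> borel_measurable (pos_borel \<Otimes>\<^sub>M pos_borel)"
    using continuous_on_mult[OF K_cont continuous_on_subset[OF _ subset_UNIV]]
    by (intro measurable_pair_pos_borel) (simp add: case_prod_unfold collision_def)
  fix v w :: real assume vw: "0 < v" "0 < w"
  define D where "D = \<bar>\<phi> (v + w) - \<phi> v - \<phi> w\<bar>"
  have D: "0 \<le> D" "D \<le> 2 * v" "D \<le> 2 * w"
    using lip0_diff[OF \<phi>, of "v + w" v] lip0_diff[OF \<phi>, of "v + w" w] lip0_le[OF \<phi>, of v]
      lip0_le[OF \<phi>, of w] vw by (auto simp: D_def)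
  have v: "v \<le> 1 + v powr \<gamma>" and w: "w \<le> 1 + w powr \<gamma>"
    using vw \<gamma> by (auto intro: le_one_plus_powr)
  let ?P = "(1 + v powr \<gamma>) * (1 + w powr \<gamma>)"
  have "\<bar>collision \<phi> v w\<bar> = K v w * D"
    using K_nonneg[OF vw] by (simp add: collision_def abs_mult D_def)
  also have "\<dots> \<le> A * (v powr \<gamma> + w powr \<gamma>) * D" using D K_le[OF vw] by (intro mult_right_mono)
  also have "\<dots> = A * (v powr \<gamma> * D + w powr \<gamma> * D)" by (simp add: algebra_simps)
  also have "\<dots> \<le> A * ((1 + v powr \<gamma>) * (2 * (1 + w powr \<gamma>)) + (1 + w powr \<gamma>) * (2 * (1 + v powr \<gamma>)))"
    using A D v w by (intro mult_left_mono add_mono mult_mono) auto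
  also have "\<dots> = 4 * A * (1 + v powr \<gamma>) * (1 + w powr \<gamma>)" by (simp add: algebra_simps)
  finally show "\<bar>collision \<phi> v w\<bar> \<le> 4 * A * (1 + v powr \<gamma>) * (1 + w powr \<gamma>)" .
qed (use A in auto)

lemma dominated_gain:
  assumes \<phi>: "\<phi> \<in> lip0" and "0 \<le> c" and "\<And>v. \<bar>\<phi> v\<bar> \<le> c"
  shows "dominated \<gamma> (A * c) (\<lambda>v w. K v w * \<phi> (v + w))"
proof (rule dominated_kernel_mult)
  show "continuous_on UNIV (\<lambda>(v, w). \<phi> (v + w))"
    unfolding case_prod_unfold
    by (intro continuous_intros continuous_on_compose2[OF continuous_on_lip0[OF \<phi>, of UNIV]]) auto
qed (use assms in auto)

lemma lip0_integrable:
  assumes "tame \<gamma> B \<mu>" "0 \<le> B" "\<phi> \<in> lip0"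
  shows "integrable \<mu> \<phi>"
proof (rule tame_integrable[OF assms(1,2), where c = 1])
  show "\<phi> \<in> borel_measurable pos_borel"
    by (rule measurable_compose[OF measurable_ident_pos_borel measurable_lip0[OF assms(3)]])
  show "\<bar>\<phi> v\<bar> \<le> 1 * (1 + v powr \<gamma>)" if "0 < v" for v
    using lip0_le[OF assms(3), of v] le_one_plus_powr[of v \<gamma>] \<gamma> that by simp
qed

text \<open>Particles in the support of \<open>\<phi>\<close> have size at most \<open>b\<close>, so each of them is lost at a rate bounded in terms of
\<open>b\<close> and the moments of \<open>\<mu>\<close>. The loss occurs twice because the collision term is symmetrised.\<close>

lemma gain_minus_loss_le:
  assumes tame: "tame \<gamma> B \<mu>" and B: "0 \<le> B"
    and \<phi>: "\<phi> \<in> lip0" "\<And>v. 0 \<le> \<phi> v" and supp: "0 < b" "\<And>v. b < v \<Longrightarrow> \<phi> v = 0" "\<And>v. \<phi> v \<le> b"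
  shows "dint \<mu> (\<lambda>v w. K v w * \<phi> (v + w)) - 2 * (A * (1 + b powr \<gamma>) * B * (\<integral>v. \<phi> v \<partial>\<mu>))
    \<le> dint \<mu> (collision \<phi>)"
proof -
  define c where "c = A * (1 + b powr \<gamma>)"
  have c: "0 \<le> c" using A by (simp add: c_def)
  let ?W = "\<integral>v. 1 + v powr \<gamma> \<partial>\<mu>" and ?u = "\<integral>v. \<phi> v \<partial>\<mu>"
  define G where "G v w = K v w * \<phi> (v + w)" for v w
  \<comment> \<open>\<open>P\<close> and \<open>Q\<close> bound the two loss terms; they are products, so their iterated integrals factorise.\<close>
  define P where "P v w = - (c * (1 + w powr \<gamma>) * \<phi> v)" for v w
  define Q where "Q v w = - (c * (1 + v powr \<gamma>) * \<phi> w)" for v w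
  have G: "dominated \<gamma> (A * b) G"
    unfolding G_def using \<phi> supp by (intro dominated_gain) auto
  have powr: "(\<lambda>v. v powr \<gamma>) \<in> borel_measurable pos_borel" by measurable
  have \<phi>m: "\<phi> \<in> borel_measurable pos_borel"
    by (rule measurable_compose[OF measurable_ident_pos_borel measurable_lip0[OF \<phi>(1)]])
  have mfst: "(\<lambda>p. h (fst p)) \<in> borel_measurable (pos_borel \<Otimes>\<^sub>M pos_borel)"
    and msnd: "(\<lambda>p. h (snd p)) \<in> borel_measurable (pos_borel \<Otimes>\<^sub>M pos_borel)"
    if "h \<in> borel_measurable pos_borel" for h :: "real \<Rightarrow> real"
    using that by (auto intro: measurable_compose[OF measurable_fst] measurable_compose[OF measurable_snd])
  have bound: "c * (1 + w powr \<gamma>) * \<phi> v \<le> c * b * (1 + v powr \<gamma>) * (1 + w powr \<gamma>)" for v w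
  proof -
    have "\<phi> v * 1 \<le> b * (1 + v powr \<gamma>)" using supp \<phi> by (intro mult_mono) auto
    then have "c * (1 + w powr \<gamma>) * (\<phi> v * 1) \<le> c * (1 + w powr \<gamma>) * (b * (1 + v powr \<gamma>))"
      using c by (intro mult_left_mono) auto
    then show ?thesis by (simp add: mult_ac)
  qed
  have P: "dominated \<gamma> (c * b) P"
    unfolding dominated_def P_def case_prod_unfold using c supp \<phi> bound
    by (auto simp: abs_mult intro!: borel_measurable_uminus borel_measurable_times borel_measurable_add
      msnd[OF powr] mfst[OF \<phi>m])
  have Q: "dominated \<gamma> (c * b) Q"
    unfolding dominated_def Q_def case_prod_unfold using c supp \<phi> bound
    by (auto simp: abs_mult mult_ac intro!: borel_measurable_uminus borel_measurable_times borel_measurable_add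
      mfst[OF powr] msnd[OF \<phi>m])
  have GP: "dominated \<gamma> (A * b + c * b) (\<lambda>v w. G v w + P v w)"
    by (rule dominated_add[OF G P])
  have GPQ: "dominated \<gamma> (A * b + c * b + c * b) (\<lambda>v w. (G v w + P v w) + Q v w)"
    by (rule dominated_add[OF GP Q])
  have K\<phi>: "K v w * \<phi> v \<le> c * (1 + w powr \<gamma>) * \<phi> v" if vw: "0 < v" "0 < w" for v w
  proof (cases "v \<le> b")
    case True
    have "K v w \<le> A * ((1 + v powr \<gamma>) * (1 + w powr \<gamma>))" by (rule K_le_product[OF vw])
    also have "\<dots> \<le> A * ((1 + b powr \<gamma>) * (1 + w powr \<gamma>))"
      using A True vw \<gamma> by (intro mult_left_mono mult_right_mono add_left_mono powr_mono2) auto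
    finally show ?thesis using \<phi>(2) by (intro mult_right_mono) (auto simp: c_def mult_ac)
  qed (use supp in auto)
  have K\<phi>': "K v w * \<phi> w \<le> c * (1 + v powr \<gamma>) * \<phi> w" if vw: "0 < v" "0 < w" for v w
  proof (cases "w \<le> b")
    case True
    have "K v w \<le> A * ((1 + v powr \<gamma>) * (1 + w powr \<gamma>))" by (rule K_le_product[OF vw])
    also have "\<dots> \<le> A * ((1 + v powr \<gamma>) * (1 + b powr \<gamma>))"
      using A True vw \<gamma> by (intro mult_left_mono add_left_mono powr_mono2) auto
    finally show ?thesis using \<phi>(2) by (intro mult_right_mono) (auto simp: c_def mult_ac)
  qed (use supp in auto)
  have u: "0 \<le> ?u" using \<phi> by (intro Bochner_Integration.integral_nonneg) auto
  have "dint \<mu> (\<lambda>v w. (G v w + P v w) + Q v w) = dint \<mu> G + dint \<mu> P + dint \<mu> Q"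
    by (simp add: dint_add[OF tame B GP Q] dint_add[OF tame B G P])
  moreover have "dint \<mu> P = - (c * ?W * ?u)" "dint \<mu> Q = - (c * ?W * ?u)"
    unfolding dint_def P_def Q_def by (simp_all add: mult_ac)
  moreover have "c * ?W * ?u \<le> c * B * ?u"
    using c u tame_integral_weight[OF tame B] by (intro mult_right_mono mult_left_mono)
  moreover have "dint \<mu> (\<lambda>v w. (G v w + P v w) + Q v w) \<le> dint \<mu> (collision \<phi>)"
  proof (rule dint_mono[OF tame B GPQ dominated_collision[OF \<phi>(1)]])
    fix v w :: real assume "0 < v" "0 < w"
    from K\<phi>[OF this] K\<phi>'[OF this] show "G v w + P v w + Q v w \<le> collision \<phi> v w"
      by (simp add: G_def P_def Q_def collision_def algebra_simps)
  qed
  ultimately show ?thesis unfolding c_def G_def by linarith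
qed

end

text \<open>If \<open>w \<le> b\<close> and \<open>v \<ge> 3 * b\<close>, then \<open>v / (v + w) \<ge> 3/4\<close>, so the angular factor is at least \<open>G0 * (1/4) powr k\<close>
and the kernel is, up to this constant, as large as its factor \<open>h\<close>.\<close>

lemma off_diagonal_kernel_if_assumption_K:
  assumes "1 < \<gamma>" "assumption_K \<gamma> K"
  shows "\<exists>A. off_diagonal_kernel \<gamma> A K" and "\<And>v. 0 < v \<Longrightarrow> K v v = 0"
proof -
  obtain h g where
    h: "continuous_on ({0..} \<times> {0..}) (\<lambda>(v, w). h v w :: real)" and
    g: "continuous_on {0..} (g :: real \<Rightarrow> real)" and
    K': "\<forall>v\<ge>0. \<forall>w\<ge>0. K v w = h v w * g (v / (v + w))" and
    K0': "\<forall>v\<ge>0. \<forall>w\<ge>0. 0 \<le> K v w" and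
    H': "\<exists>H>1. \<exists>H0>0. \<forall>v\<ge>0. \<forall>w\<ge>0. v + w > H \<longrightarrow> H0 * (v powr \<gamma> + w powr \<gamma>) \<le> h v w" and
    loc': "\<forall>R>0. \<exists>C>0. \<forall>v\<in>{1/R..R}. \<forall>w\<in>{1/R..R}. C \<le> h v w" and
    H1': "\<exists>H1>0. \<forall>v\<ge>0. \<forall>w\<ge>0. h v w \<le> H1 * (v powr \<gamma> + w powr \<gamma>)" and
    g0: "g (1/2) = 0" and
    G': "\<exists>G0>0. \<exists>G1>0. \<exists>k\<ge>1. \<forall>x\<in>{0..1}. G0 * \<bar>x - 1/2\<bar> powr k \<le> g x \<and> g x \<le> G1"
    using assms(2) unfolding assumption_K_def by - (erule conjE, erule exE, erule exE, (erule conjE)+, rule that)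
  have K: "K v w = h v w * g (v / (v + w))" and K0: "0 \<le> K v w" if "0 \<le> v" "0 \<le> w" for v w
    using K' K0' that by blast+
  obtain H H0 where H: "1 < H" "0 < H0"
    "\<And>v w. 0 \<le> v \<Longrightarrow> 0 \<le> w \<Longrightarrow> H < v + w \<Longrightarrow> H0 * (v powr \<gamma> + w powr \<gamma>) \<le> h v w"
    using H' by metis
  have loc: "\<exists>C>0. \<forall>v\<in>{1/R..R}. \<forall>w\<in>{1/R..R}. C \<le> h v w" if "0 < R" for R
    using loc' that by blast
  obtain H1 where H1: "0 < H1" "\<And>v w. 0 \<le> v \<Longrightarrow> 0 \<le> w \<Longrightarrow> h v w \<le> H1 * (v powr \<gamma> + w powr \<gamma>)"
    using H1' by metis
  obtain G0 G1 k where G: "0 < G0" "0 < G1" "1 \<le> k"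
    "\<And>x. x \<in> {0..1} \<Longrightarrow> G0 * \<bar>x - 1/2\<bar> powr k \<le> g x" "\<And>x. x \<in> {0..1} \<Longrightarrow> g x \<le> G1"
    using G' by metis
  show "K v v = 0" if "0 < v" for v using K[of v v] that g0 by simp
  have hpos: "0 < h v w" if "0 < v" "0 < w" for v w
  proof -
    define R where "R = max (max v w) (max (1 / v) (1 / w))"
    have R: "v \<le> R" "w \<le> R" "1 / v \<le> R" "1 / w \<le> R" by (auto simp: R_def)
    then have "0 < R" using that by linarith
    from loc[OF this] obtain C where C: "0 < C" "\<forall>v\<in>{1/R..R}. \<forall>w\<in>{1/R..R}. C \<le> h v w"
      by blast
    have "1 / R \<le> v" "1 / R \<le> w" using R that \<open>0 < R\<close> by (auto simp: field_simps)
    then have "C \<le> h v w" using C(2) R by auto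
    with C show ?thesis by simp
  qed
  have frac: "v / (v + w) \<in> {0..1}" if "0 < v" "0 < w" for v w :: real using that by auto
  have "off_diagonal_kernel \<gamma> (H1 * G1) K"
  proof
    show "1 < \<gamma>" "0 \<le> H1 * G1" using assms H1 G by auto
    show "0 \<le> K v w" if "0 < v" "0 < w" for v w using K0 that by simp
    show "K v w \<le> H1 * G1 * (v powr \<gamma> + w powr \<gamma>)" if vw: "0 < v" "0 < w" for v w
    proof -
      have "0 \<le> g (v / (v + w))" using G(1) G(4)[OF frac[OF vw]]
        by (meson mult_nonneg_nonneg order_less_imp_le order_trans powr_ge_zero)
      then have "h v w * g (v / (v + w)) \<le> (H1 * (v powr \<gamma> + w powr \<gamma>)) * G1"
        using vw H1 G(5)[OF frac[OF vw]] by (intro mult_mono) auto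
      then show ?thesis using K[of v w] vw by (simp add: mult_ac)
    qed
    have "continuous_on ({0<..} \<times> {0<..}) (\<lambda>p. h (fst p) (snd p) * g (fst p / (fst p + snd p)))"
    proof (intro continuous_on_mult)
      show "continuous_on ({0<..} \<times> {0<..}) (\<lambda>p. h (fst p) (snd p))"
        by (rule continuous_on_subset[OF h[unfolded case_prod_unfold]]) auto
      show "continuous_on ({0<..} \<times> {0<..}) (\<lambda>p. g (fst p / (fst p + snd p)))"
        by (rule continuous_on_compose2[OF g]) (auto intro!: continuous_intros)
    qed
    then show "continuous_on ({0<..} \<times> {0<..}) (case_prod K)"
      by (rule continuous_on_cong[THEN iffD1, OF refl, rotated]) (auto simp: K)
    show "0 < K v w" if vw: "0 < v" "0 < w" "v \<noteq> w" for v w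
    proof -
      have "v / (v + w) \<noteq> 1/2" using vw by (simp add: field_simps)
      then have "0 < G0 * \<bar>v / (v + w) - 1/2\<bar> powr k" using G by simp
      also have "\<dots> \<le> g (v / (v + w))" by (rule G(4)[OF frac[OF vw(1,2)]])
      finally show ?thesis using K[of v w] hpos vw by simp
    qed
    show "\<exists>N>0. \<exists>\<kappa>>0. \<forall>v\<ge>N. \<forall>w. 0 < w \<and> w \<le> b \<longrightarrow> \<kappa> * v powr \<gamma> \<le> K v w" if b: "0 < b" for b
    proof (intro exI conjI allI impI)
      show "0 < max H (3 * b)" "0 < H0 * (G0 * (1/4) powr k)" using H G by auto
      fix v w assume "max H (3 * b) \<le> v" and "0 < w \<and> w \<le> b"
      then have vw: "0 < v" "0 < w" "H < v + w" "3 * w \<le> v" using b H by auto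
      have "1/4 \<le> v / (v + w) - 1/2" using vw by (simp add: field_simps)
      then have "1/4 \<le> \<bar>v / (v + w) - 1/2\<bar>" by linarith
      then have "(1/4) powr k \<le> \<bar>v / (v + w) - 1/2\<bar> powr k" using G(3) by (intro powr_mono2) auto
      then have "G0 * (1/4) powr k \<le> G0 * \<bar>v / (v + w) - 1/2\<bar> powr k" using G by simp
      also have "\<dots> \<le> g (v / (v + w))" by (rule G(4)[OF frac[OF vw(1,2)]])
      finally have gl: "G0 * (1/4) powr k \<le> g (v / (v + w))" .
      have "H0 * v powr \<gamma> \<le> H0 * (v powr \<gamma> + w powr \<gamma>)" using H by simp
      also have "\<dots> \<le> h v w" using H vw by simp
      finally have "(H0 * v powr \<gamma>) * (G0 * (1/4) powr k) \<le> h v w * g (v / (v + w))"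
        using gl H G hpos[of v w] vw by (intro mult_mono) auto
      then show "H0 * (G0 * (1/4) powr k) * v powr \<gamma> \<le> K v w" using K[of v w] vw by (simp add: mult_ac)
    qed
  qed
  then show "\<exists>A. off_diagonal_kernel \<gamma> A K" ..
qed

section \<open>A solution does not charge two sizes\<close>

text \<open>The points of the support of \<open>\<mu>\<close> in the open half-line, expressed by continuous tents instead of open
intervals so that the weak formulation applies directly.\<close>

definition charged :: "real measure \<Rightarrow> real \<Rightarrow> bool" where
  "charged \<mu> x \<longleftrightarrow> 0 < x \<and> (\<forall>e. 0 < e \<and> e < x \<longrightarrow> 0 < (\<integral>v. bump x e v \<partial>\<mu>))"

locale coagulation_flow = off_diagonal_kernel +
  fixes T B :: real and f_in :: "real measure" and f :: "real \<Rightarrow> real measure"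
  assumes T: "0 < T" and B: "0 < B"
    and tame: "\<And>s. s \<in> {0..T} \<Longrightarrow> tame \<gamma> B (f s)"
    and vague_cont: "\<And>\<phi>. \<phi> \<in> Cc_pos \<Longrightarrow> continuous_on {0..T} (\<lambda>s. \<integral>v. \<phi> v \<partial>f s)"
    and weak: "\<And>\<phi> t. \<phi> \<in> Cc_pos \<Longrightarrow> t \<in> {0..T} \<Longrightarrow>
      (\<integral>v. \<phi> v \<partial>f t) - (\<integral>v. \<phi> v \<partial>f_in) = 1/2 * (LBINT s:{0..t}. dint (f s) (collision \<phi>))"
begin

lemma B': "0 \<le> B" using B by simp

definition rate :: "(real \<Rightarrow> real) \<Rightarrow> real \<Rightarrow> real" where
  "rate \<phi> s = dint (f s) (collision \<phi>)"

definition obs :: "(real \<Rightarrow> real) \<Rightarrow> real \<Rightarrow> real" where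
  "obs \<phi> s = (\<integral>v. \<phi> v \<partial>f s)"

lemma rate_bound:
  assumes "\<phi> \<in> lip0" "s \<in> {0..T}"
  shows "\<bar>rate \<phi> s\<bar> \<le> 4 * A * B * B"
  unfolding rate_def by (rule dint_bound[OF tame[OF assms(2)] B' dominated_collision[OF assms(1)]])

lemma rate_integrable:
  assumes \<phi>: "\<phi> \<in> lip0" and "0 \<le> s" "t \<le> T"
  shows "set_integrable lborel {s<..t} (rate \<phi>)"
proof -
  have "rate \<phi> \<in> borel_measurable (restrict_space borel {0..T})"
    unfolding rate_def
    by (rule measurable_dint_flow[OF tame B vague_cont dominated_collision[OF \<phi>]])
  then have m: "(\<lambda>s. indicator {0..T} s *\<^sub>R rate \<phi> s) \<in> borel_measurable lborel"
    by (simp add: borel_measurable_restrict_space_iff)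
  have "integrable lborel (\<lambda>s. indicator {0..T} s *\<^sub>R (indicator {0..T} s *\<^sub>R rate \<phi> s))"
    using T rate_bound[OF \<phi>] by (intro integrableI_bounded_set_indicator[OF _ m]) auto
  then have "set_integrable lborel {0..T} (rate \<phi>)"
    unfolding set_integrable_def by (rule Bochner_Integration.integrable_cong[THEN iffD1, OF refl, rotated])
      (simp add: indicator_def)
  then show ?thesis by (rule set_integrable_subset) (use assms in auto)
qed

text \<open>The weak formulation between two arbitrary times. Half-open intervals make the time integrals additive.\<close>

definition balanced :: "(real \<Rightarrow> real) \<Rightarrow> bool" where
  "balanced \<phi> \<longleftrightarrow> \<phi> \<in> lip0 \<and> (\<forall>s t. 0 \<le> s \<longrightarrow> s \<le> t \<longrightarrow> t \<le> T \<longrightarrow>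
     obs \<phi> t - obs \<phi> s = 1/2 * (LBINT r:{s<..t}. rate \<phi> r))"

lemma obs_0:
  assumes "\<phi> \<in> Cc_pos"
  shows "obs \<phi> 0 = (\<integral>v. \<phi> v \<partial>f_in)"
proof -
  have "AE r in lborel. r \<noteq> (0::real)" by (rule AE_lborel_singleton)
  then have "AE r in lborel. indicator {0..0::real} r *\<^sub>R dint (f r) (collision \<phi>) = 0"
    by eventually_elim auto
  then have "(LBINT r:{0..0}. dint (f r) (collision \<phi>)) = 0"
    unfolding set_lebesgue_integral_def by (rule integral_eq_zero_AE)
  with weak[OF assms, of 0] T show ?thesis by (simp add: obs_def)
qed

lemma balanced_Cc_pos:
  assumes "\<phi> \<in> lip0" "\<phi> \<in> Cc_pos"
  shows "balanced \<phi>"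
  unfolding balanced_def
proof (intro conjI allI impI)
  fix s t :: real assume st: "0 \<le> s" "s \<le> t" "t \<le> T"
  have from0: "obs \<phi> t - obs \<phi> 0 = 1/2 * (LBINT r:{0<..t}. rate \<phi> r)" if "t \<in> {0..T}" for t
  proof -
    have eq: "indicator {0..t} r *\<^sub>R rate \<phi> r = indicator {0<..t} r *\<^sub>R rate \<phi> r
        + indicator {0} r *\<^sub>R rate \<phi> 0" for r
      using that by (auto simp: indicator_def)
    have "(LBINT r:{0..t}. rate \<phi> r) = (LBINT r:{0<..t}. rate \<phi> r)"
      unfolding set_lebesgue_integral_def eq
      using rate_integrable[OF assms(1), of 0 t] that
      by (subst Bochner_Integration.integral_add) (auto simp: set_integrable_def)
    with weak[OF assms(2) that] obs_0[OF assms(2)] show ?thesis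
      by (simp add: obs_def rate_def)
  qed
  have "{0<..t} = {0<..s} \<union> {s<..t}" using st by auto
  then have "(LBINT r:{0<..t}. rate \<phi> r) = (LBINT r:{0<..s}. rate \<phi> r) + (LBINT r:{s<..t}. rate \<phi> r)"
    using st by (simp add: set_integral_Un rate_integrable[OF assms(1)])
  with from0[of s] from0[of t] st show "obs \<phi> t - obs \<phi> s = 1/2 * (LBINT r:{s<..t}. rate \<phi> r)"
    by simp
qed (rule assms)

text \<open>Membership in \<open>lip0\<close> bounds all collision terms by the same constant, which allows dominated convergence in
both size variables and in time.\<close>

lemma balanced_limit:
  assumes bal: "\<And>i. balanced (\<phi> i)" and \<psi>: "\<psi> \<in> lip0"
    and lim: "\<And>v. 0 < v \<Longrightarrow> (\<lambda>i. \<phi> i v) \<longlonglongrightarrow> \<psi> v"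
  shows "balanced \<psi>"
  unfolding balanced_def
proof (intro conjI allI impI)
  have \<phi>: "\<phi> i \<in> lip0" for i using bal by (simp add: balanced_def)
  fix s t :: real assume st: "0 \<le> s" "s \<le> t" "t \<le> T"
  have obs: "(\<lambda>i. obs (\<phi> i) r) \<longlonglongrightarrow> obs \<psi> r" if r: "r \<in> {0..T}" for r
    unfolding obs_def
  proof (rule integral_dominated_convergence)
    note meas = borel_measurable_integrable[OF lip0_integrable[OF tame[OF r] B']]
    show "\<psi> \<in> borel_measurable (f r)" "\<phi> i \<in> borel_measurable (f r)" for i
      by (intro meas \<psi> \<phi>)+
    show "integrable (f r) (\<lambda>v. 1 + v powr \<gamma>)" by (rule tame_integrable_weight[OF tame[OF r] B'])
    show "AE v in f r. (\<lambda>i. \<phi> i v) \<longlonglongrightarrow> \<psi> v"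
      using lim by (intro AE_I2) (auto simp: tame_space[OF tame[OF r] B'])
    show "AE v in f r. norm (\<phi> i v) \<le> 1 + v powr \<gamma>" for i
    proof (rule AE_I2)
      fix v assume "v \<in> space (f r)"
      then have "0 < v" by (simp add: tame_space[OF tame[OF r] B'])
      then show "norm (\<phi> i v) \<le> 1 + v powr \<gamma>"
        using lip0_le[OF \<phi>, of i v] le_one_plus_powr[of v \<gamma>] \<gamma> by simp
    qed
  qed
  have rate: "(\<lambda>i. rate (\<phi> i) r) \<longlonglongrightarrow> rate \<psi> r" if r: "r \<in> {0..T}" for r
    unfolding rate_def
    by (rule dint_tendsto[OF tame[OF r] B' dominated_collision[OF \<phi>] dominated_collision[OF \<psi>]])
      (auto simp: collision_def intro!: tendsto_intros lim)
  have "(\<lambda>i. LBINT r:{s<..t}. rate (\<phi> i) r) \<longlonglongrightarrow> (LBINT r:{s<..t}. rate \<psi> r)"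
    unfolding set_lebesgue_integral_def
  proof (rule integral_dominated_convergence)
    have meas: "(\<lambda>r. indicator {s<..t} r *\<^sub>R rate \<xi> r) \<in> borel_measurable lborel" if "\<xi> \<in> lip0" for \<xi>
      using rate_integrable[OF that st(1,3)] unfolding set_integrable_def
      by (rule borel_measurable_integrable)
    show "(\<lambda>r. indicator {s<..t} r *\<^sub>R rate \<psi> r) \<in> borel_measurable lborel"
      "(\<lambda>r. indicator {s<..t} r *\<^sub>R rate (\<phi> i) r) \<in> borel_measurable lborel" for i
      by (intro meas \<psi> \<phi>)+
    show "integrable lborel (\<lambda>r. indicator {s<..t} r *\<^sub>R (4 * A * B * B))"
      using st by (simp add: integrable_real_indicator)
    show "AE r in lborel. (\<lambda>i. indicator {s<..t} r *\<^sub>R rate (\<phi> i) r) \<longlonglongrightarrow> indicator {s<..t} r *\<^sub>R rate \<psi> r"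
      using rate st by (intro AE_I2) (auto simp: indicator_def)
    show "AE r in lborel. norm (indicator {s<..t} r *\<^sub>R rate (\<phi> i) r) \<le> indicator {s<..t} r *\<^sub>R (4 * A * B * B)" for i
      using rate_bound[OF \<phi>, of _ i] st by (intro AE_I2) (auto simp: indicator_def)
  qed
  then have "(\<lambda>i. 1/2 * (LBINT r:{s<..t}. rate (\<phi> i) r)) \<longlonglongrightarrow> 1/2 * (LBINT r:{s<..t}. rate \<psi> r)"
    by (intro tendsto_intros)
  moreover have lim_obs: "(\<lambda>i. obs (\<phi> i) t - obs (\<phi> i) s) \<longlonglongrightarrow> obs \<psi> t - obs \<psi> s"
    using st by (intro tendsto_diff obs) auto
  have eq: "obs (\<phi> i) t - obs (\<phi> i) s = 1/2 * (LBINT r:{s<..t}. rate (\<phi> i) r)" for i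
    using bal[of i] st unfolding balanced_def by blast
  ultimately show "obs \<psi> t - obs \<psi> s = 1/2 * (LBINT r:{s<..t}. rate \<psi> r)"
    using LIMSEQ_unique lim_obs[unfolded eq] by blast
qed (rule \<psi>)

lemma balanced_tail: "0 < n \<Longrightarrow> balanced (tail n)"
  by (rule balanced_limit[where \<phi> = "\<lambda>i. truncated_tail n (real i)"])
    (auto intro: balanced_Cc_pos truncated_tail_lip0 truncated_tail_Cc_pos tail_lip0
      truncated_tail_LIMSEQ less_imp_le)

lemma balancedD:
  assumes "balanced \<phi>" "0 \<le> s" "s \<le> t" "t \<le> T"
  shows "obs \<phi> t - obs \<phi> s = 1/2 * (LBINT r:{s<..t}. rate \<phi> r)"
  using assms by (simp add: balanced_def)

lemma obs_continuous:
  assumes "balanced \<phi>"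
  shows "continuous_on {0..T} (obs \<phi>)"
proof -
  have \<phi>: "\<phi> \<in> lip0" using assms by (simp add: balanced_def)
  have *: "\<bar>obs \<phi> t - obs \<phi> s\<bar> \<le> 2 * A * B * B * \<bar>t - s\<bar>" if st: "0 \<le> s" "s \<le> t" "t \<le> T" for s t
  proof -
    have "(LBINT r:{s<..t}. rate \<phi> r) \<le> 4 * A * B * B * (t - s)"
      using st rate_bound[OF \<phi>] by (intro set_integral_Ioc_le rate_integrable[OF \<phi>]) (auto simp: abs_le_iff)
    moreover have "(LBINT r:{s<..t}. - rate \<phi> r) \<le> 4 * A * B * B * (t - s)"
      using st rate_bound[OF \<phi>] rate_integrable[OF \<phi> st(1,3)]
      by (intro set_integral_Ioc_le) (auto simp: abs_le_iff set_integrable_def)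
    ultimately show ?thesis
      using st by (simp add: balancedD[OF assms] set_lebesgue_integral_def abs_le_iff)
  qed
  have "(2 * A * B * B)-lipschitz_on {0..T} (obs \<phi>)"
  proof (rule lipschitz_onI)
    fix s t assume "s \<in> {0..T}" "t \<in> {0..T}"
    then show "dist (obs \<phi> s) (obs \<phi> t) \<le> 2 * A * B * B * dist s t"
      using *[of s t] *[of t s] by (cases "s \<le> t") (auto simp: dist_real_def abs_minus_commute)
  qed (use A B in auto)
  then show ?thesis by (rule lipschitz_on_continuous_on)
qed

lemma obs_nonneg: "(\<And>v. 0 \<le> \<phi> v) \<Longrightarrow> 0 \<le> obs \<phi> s"
  unfolding obs_def by (rule Bochner_Integration.integral_nonneg) auto

text \<open>Gain is nonnegative and the loss is linear in the observable itself, so positivity persists.\<close>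

lemma obs_positive:
  assumes \<phi>: "\<phi> \<in> lip0" "\<phi> \<in> Cc_pos" "\<And>v. 0 \<le> \<phi> v"
    and supp: "0 < b" "\<And>v. b < v \<Longrightarrow> \<phi> v = 0" "\<And>v. \<phi> v \<le> b"
    and st: "0 \<le> s" "s \<le> t" "t \<le> T" and pos: "0 < obs \<phi> s"
  shows "0 < obs \<phi> t"
proof -
  define C where "C = A * (1 + b powr \<gamma>) * B"
  have C: "0 \<le> C" using A B by (auto simp: C_def)
  have bal: "balanced \<phi>" by (rule balanced_Cc_pos[OF \<phi>(1,2)])
  note cont = obs_continuous[OF bal]
  show ?thesis
  proof (rule positive_if_linear_loss[OF cont _ C _ st pos])
    show "0 \<le> obs \<phi> r" for r by (rule obs_nonneg[OF \<phi>(3)])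
    fix r t assume rt: "0 \<le> r" "r \<le> t" "t \<le> T"
    have ge: "- (2 * C) * obs \<phi> q \<le> rate \<phi> q" if q: "q \<in> {0..T}" for q
    proof -
      have "0 \<le> dint (f q) (\<lambda>v w. K v w * \<phi> (v + w))"
        unfolding dint_def using K_nonneg \<phi>(3)
        by (intro Bochner_Integration.integral_nonneg) (auto simp: tame_space[OF tame[OF q] B'])
      then show ?thesis
        using gain_minus_loss_le[OF tame[OF q] B' \<phi>(1,3) supp]
        by (simp add: rate_def obs_def C_def)
    qed
    have int: "set_integrable lborel {r<..t} (obs \<phi>)"
      using rt by (intro set_integrable_Ioc_continuous[OF cont])
    have "- (2 * C) * (LBINT q:{r<..t}. obs \<phi> q) = (LBINT q:{r<..t}. - (2 * C) * obs \<phi> q)"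
      by (rule set_integral_mult_right[symmetric])
    also have "\<dots> \<le> (LBINT q:{r<..t}. rate \<phi> q)"
      using rt by (intro set_integral_mono set_integrable_mult_right int rate_integrable[OF \<phi>(1)] ge) auto
    finally show "obs \<phi> r - C * (LBINT q:{r<..t}. obs \<phi> q) \<le> obs \<phi> t"
      using balancedD[OF bal rt] by simp
  qed
qed

lemma obs_bump_positive:
  assumes "0 < e" "e < x" "0 \<le> s" "s \<le> t" "t \<le> T" "0 < obs (bump x e) s"
  shows "0 < obs (bump x e) t"
proof (rule obs_positive[OF bump_lip0 bump_Cc_pos bump_nonneg _ _ _ assms(3-6)])
  show "0 < x + e" using assms by simp
  show "bump x e v = 0" if "x + e < v" for v using assms that by (auto simp: bump_def)
  show "bump x e v \<le> x + e" for v using assms by (auto simp: bump_def)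
qed (use assms in auto)

lemma charged_mono:
  assumes "charged (f s) x" "0 \<le> s" "s \<le> t" "t \<le> T"
  shows "charged (f t) x"
  using assms obs_bump_positive[of _ x s t] by (auto simp: charged_def obs_def)

text \<open>If no mass were near \<open>x + y\<close> at time \<open>t\<close>, there would have been none before, by persistence of positivity.
But then the balance for a tent at \<open>x + y\<close> has no loss term, and its gain is strictly positive at all earlier
positive times: particles near \<open>x\<close> and near \<open>y\<close> are present, and they do collide because \<open>x \<noteq> y\<close>.\<close>

lemma charged_add:
  assumes "x \<noteq> y" and x: "\<And>s. s \<in> {0<..T} \<Longrightarrow> charged (f s) x"
    and y: "\<And>s. s \<in> {0<..T} \<Longrightarrow> charged (f s) y" and t: "t \<in> {0<..T}"
  shows "charged (f t) (x + y)"
  unfolding charged_def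
proof (intro conjI allI impI)
  have xy: "0 < x" "0 < y" using x[OF t] y[OF t] by (auto simp: charged_def)
  then show "0 < x + y" by simp
  fix e assume e: "0 < e \<and> e < x + y"
  define \<phi> where "\<phi> = bump (x + y) e"
  have \<phi>: "\<phi> \<in> lip0" "\<phi> \<in> Cc_pos" using e by (auto simp: \<phi>_def bump_lip0 bump_Cc_pos)
  have bal: "balanced \<phi>" by (rule balanced_Cc_pos[OF \<phi>])
  show "0 < (\<integral>v. bump (x + y) e v \<partial>f t)"
  proof (rule ccontr)
    assume "\<not> ?thesis"
    then have "\<not> 0 < obs \<phi> t" by (simp add: \<phi>_def obs_def)
    have zero: "obs \<phi> s = 0" if s: "s \<in> {0..t}" for s
    proof -
      have "\<not> 0 < obs \<phi> s"
        using \<open>\<not> 0 < obs \<phi> t\<close> obs_bump_positive[of e "x + y" s t] e s t by (auto simp: \<phi>_def)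
      moreover have "0 \<le> obs \<phi> s" by (rule obs_nonneg) (simp add: \<phi>_def)
      ultimately show ?thesis by simp
    qed
    \<comment> \<open>Tents of radius \<open>\<eta>\<close> around \<open>x\<close> and \<open>y\<close> do not meet, and sums of their points lie within \<open>e\<close> of \<open>x + y\<close>.\<close>
    define \<eta> where "\<eta> = min (min (e / 2) (\<bar>x - y\<bar> / 2)) (min (x / 2) (y / 2))"
    have "0 < \<eta>" using xy e \<open>x \<noteq> y\<close> by (simp add: \<eta>_def)
    moreover have "\<eta> \<le> e / 2" unfolding \<eta>_def by linarith
    moreover have "\<eta> \<le> \<bar>x - y\<bar> / 2" unfolding \<eta>_def by linarith
    moreover have "\<eta> < x" using xy unfolding \<eta>_def by linarith
    moreover have "\<eta> < y" using xy unfolding \<eta>_def by linarith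
    ultimately have \<eta>: "0 < \<eta>" "\<eta> \<le> e / 2" "\<eta> \<le> \<bar>x - y\<bar> / 2" "\<eta> < x" "\<eta> < y" .
    have pos: "0 < rate \<phi> s" if s: "s \<in> {0<..t}" for s
    proof -
      have s': "s \<in> {0<..T}" "s \<in> {0..T}" using s t by auto
      have "0 < dint (f s) (\<lambda>v w. K v w * \<phi> (v + w))"
      proof (rule dint_pos[OF tame[OF s'(2)] B' dominated_gain[OF \<phi>(1)],
            where \<phi> = "bump x \<eta>" and \<theta> = "bump y \<eta>"])
        show "0 \<le> e" "\<bar>\<phi> v\<bar> \<le> e" for v using e by (auto simp: \<phi>_def bump_def)
        show "0 \<le> K v w * \<phi> (v + w)" if "0 < v" "0 < w" for v w
          using K_nonneg that by (simp add: \<phi>_def)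
        show "0 < (\<integral>v. bump x \<eta> v \<partial>f s)" "0 < (\<integral>v. bump y \<eta> v \<partial>f s)"
          using x[OF s'(1)] y[OF s'(1)] \<eta> by (auto simp: charged_def)
        fix v w :: real assume vw: "0 < v" "0 < w" "0 < bump x \<eta> v" "0 < bump y \<eta> w"
        then have "v \<noteq> w" using \<eta> by (auto simp: bump_pos_iff)
        moreover have "0 < \<phi> (v + w)" using vw \<eta> by (auto simp: bump_pos_iff \<phi>_def)
        ultimately show "0 < K v w * \<phi> (v + w)" using K_pos vw by simp
      qed auto
      moreover have "dint (f s) (\<lambda>v w. K v w * \<phi> (v + w))
          - 2 * (A * (1 + (x + y + e) powr \<gamma>) * B * (\<integral>v. \<phi> v \<partial>f s)) \<le> rate \<phi> s"
        unfolding rate_def using xy e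
        by (intro gain_minus_loss_le[OF tame[OF s'(2)] B' \<phi>(1)]) (auto simp: \<phi>_def bump_def)
      moreover have "(\<integral>v. \<phi> v \<partial>f s) = 0" using zero[of s] s by (simp add: obs_def)
      ultimately show ?thesis by simp
    qed
    have "0 < (\<integral>r. indicator {0<..t} r *\<^sub>R rate \<phi> r \<partial>lborel)"
    proof (rule integral_pos_if_pos_where[where \<phi> = "indicator {0<..t}"])
      show "integrable lborel (\<lambda>r. indicator {0<..t} r *\<^sub>R rate \<phi> r)"
        using rate_integrable[OF \<phi>(1), of 0 t] t by (simp add: set_integrable_def)
      show "0 < (\<integral>r. indicator {0<..t} r \<partial>lborel :: real)" using t by simp
    qed (use pos in \<open>auto simp: indicator_def less_imp_le\<close>)
    moreover have "obs \<phi> t - obs \<phi> 0 = 1/2 * (\<integral>r. indicator {0<..t} r *\<^sub>R rate \<phi> r \<partial>lborel)"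
      using balancedD[OF bal, of 0 t] t by (simp add: set_lebesgue_integral_def)
    ultimately show False using zero[of t] zero[of 0] t by simp
  qed
qed

lemma tail_superadditive:
  assumes "0 \<le> n" "0 < v" "0 < w"
  shows "0 \<le> tail n (v + w) - tail n v - tail n w"
  using assms by (auto simp: tail_def max_def)

lemma obs_tail_mono:
  assumes "0 < n" "0 \<le> s" "s \<le> t" "t \<le> T"
  shows "obs (tail n) s \<le> obs (tail n) t"
proof -
  have "0 \<le> rate (tail n) r" if "r \<in> {0..T}" for r
    unfolding rate_def dint_def collision_def using K_nonneg tail_superadditive[of n] assms
    by (intro Bochner_Integration.integral_nonneg)
      (auto simp: tame_space[OF tame[OF that] B'] intro!: mult_nonneg_nonneg)
  then have "0 \<le> (LBINT r:{s<..t}. rate (tail n) r)"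
    unfolding set_lebesgue_integral_def using assms
    by (intro Bochner_Integration.integral_nonneg) (auto simp: indicator_def)
  then show ?thesis using balancedD[OF balanced_tail[OF assms(1)] assms(2-4)] by simp
qed

text \<open>This is the mechanism of gelation. Absorbing one particle of size at least \<open>d\<close> moves a particle from beyond
\<open>n\<close> to beyond \<open>n + d\<close>, since \<open>tail (n + d) (v + d) = tail n v\<close>. Small particles, those in the support of the
tent around \<open>2 * d\<close>, are at least \<open>m / d\<close> in number because the height of the tent is \<open>d\<close>, and they are absorbed at
a rate of order \<open>n powr \<gamma>\<close>. All other collisions can only increase the tail, which is superadditive.\<close>

lemma tail_rate_lower:
  assumes d: "0 < d" and \<kappa>: "0 \<le> \<kappa>" "\<And>v w. n \<le> v \<Longrightarrow> 0 < w \<Longrightarrow> w \<le> 3 * d \<Longrightarrow> \<kappa> * v powr \<gamma> \<le> K v w"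
    and n: "2 * d \<le> n" and m: "0 \<le> m" "m \<le> obs (bump (2 * d) d) s" and s: "s \<in> {0..T}"
  shows "\<kappa> * n powr \<gamma> * (m / d) * (obs (tail n) s - obs (tail (n + d)) s) \<le> rate (tail (n + d)) s"
proof -
  define \<theta> where "\<theta> = bump (2 * d) d"
  define G where "G v w = \<kappa> * n powr \<gamma> / d * \<theta> w * (tail n v - tail (n + d) v)" for v w
  let ?c = "\<kappa> * n powr \<gamma> / d"
  have c: "0 \<le> ?c" using d \<kappa> by simp
  have \<theta>: "\<theta> w \<le> d" "0 \<le> \<theta> w" for w using d by (auto simp: \<theta>_def bump_def)
  have \<Delta>: "0 \<le> tail n v - tail (n + d) v" "tail n v - tail (n + d) v \<le> d" for v
    using d by (auto simp: tail_def max_def)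
  have G: "dominated \<gamma> (?c * d * d) G"
    unfolding dominated_def
  proof (intro conjI allI impI)
    show "case_prod G \<in> borel_measurable (pos_borel \<Otimes>\<^sub>M pos_borel)"
      unfolding G_def case_prod_unfold \<theta>_def tail_def
      by (intro measurable_pair_pos_borel continuous_intros continuous_on_compose2[OF continuous_on_bump[of UNIV]]) auto
    fix v w :: real
    have "\<bar>G v w\<bar> = ?c * \<theta> w * (tail n v - tail (n + d) v)"
      unfolding G_def using c \<theta>(2)[of w] \<Delta>(1)[of v] by (intro abs_of_nonneg mult_nonneg_nonneg)
    also have "\<dots> \<le> ?c * d * d" using c \<theta> \<Delta> d \<kappa>(1) by (intro mult_mono) auto
    also have "\<dots> = ?c * d * d * (1 * 1)" by simp
    also have "\<dots> \<le> ?c * d * d * ((1 + v powr \<gamma>) * (1 + w powr \<gamma>))"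
      using c d \<kappa>(1) by (intro mult_left_mono mult_mono) auto
    finally show "\<bar>G v w\<bar> \<le> ?c * d * d * (1 + v powr \<gamma>) * (1 + w powr \<gamma>)" by (simp only: mult.assoc)
  qed (use c d \<kappa>(1) in auto)
  have n0: "0 < n" "0 \<le> n + d" using n d by auto
  note intg = lip0_integrable[OF tame[OF s] B' tail_lip0]
  have "dint (f s) G = ?c * obs \<theta> s * (obs (tail n) s - obs (tail (n + d)) s)"
    unfolding dint_def G_def obs_def using n0
    by (simp add: Bochner_Integration.integral_diff intg mult_ac)
  then have "?c * obs \<theta> s * (obs (tail n) s - obs (tail (n + d)) s) = dint (f s) G" by simp
  also have "dint (f s) G \<le> rate (tail (n + d)) s"
    unfolding rate_def
  proof (rule dint_mono[OF tame[OF s] B' G dominated_collision[OF tail_lip0[OF n0(2)]]])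
    fix v w :: real assume vw: "0 < v" "0 < w"
    have sup: "0 \<le> tail (n + d) (v + w) - tail (n + d) v - tail (n + d) w"
      by (rule tail_superadditive[OF n0(2) vw])
    show "G v w \<le> collision (tail (n + d)) v w"
    proof (cases "n < v \<and> 0 < \<theta> w")
      case True
      then have w: "d < w" "w < 3 * d" by (auto simp: \<theta>_def bump_pos_iff)
      have "tail n v - tail (n + d) v \<le> tail (n + d) (v + w) - tail (n + d) v - tail (n + d) w"
        using w n vw True by (auto simp: tail_def max_def)
      moreover have "?c * \<theta> w \<le> K v w"
      proof -
        have "?c * \<theta> w \<le> ?c * d" using c \<theta> by (intro mult_left_mono)
        also have "\<dots> = \<kappa> * n powr \<gamma>" using d by simp
        also have "\<dots> \<le> \<kappa> * v powr \<gamma>" using True n0 \<gamma> \<kappa>(1) by (intro mult_left_mono powr_mono2) auto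
        also have "\<dots> \<le> K v w" using True w vw by (intro \<kappa>(2)) auto
        finally show ?thesis .
      qed
      ultimately show ?thesis unfolding G_def collision_def
        using c \<theta>(2)[of w] \<Delta>(1)[of v] K_nonneg[OF vw] by (intro mult_mono) auto
    next
      case False
      then have "G v w = 0" using \<theta>(2)[of w] d by (auto simp: G_def tail_def)
      then show ?thesis unfolding collision_def using K_nonneg[OF vw] sup by simp
    qed
  qed
  finally have le: "?c * obs \<theta> s * (obs (tail n) s - obs (tail (n + d)) s) \<le> rate (tail (n + d)) s" .
  have "0 \<le> obs (tail n) s - obs (tail (n + d)) s"
  proof -
    have "0 \<le> (\<integral>v. tail n v - tail (n + d) v \<partial>f s)" using \<Delta> by (intro Bochner_Integration.integral_nonneg)
    also have "\<dots> = obs (tail n) s - obs (tail (n + d)) s"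
      unfolding obs_def using n0 by (intro Bochner_Integration.integral_diff intg) auto
    finally show ?thesis .
  qed
  then have "?c * m * (obs (tail n) s - obs (tail (n + d)) s)
      \<le> ?c * obs \<theta> s * (obs (tail n) s - obs (tail (n + d)) s)"
    using m c by (intro mult_right_mono mult_left_mono) (auto simp: \<theta>_def)
  with le show ?thesis by (simp add: mult_ac)
qed

lemma obs_tail_LIMSEQ:
  assumes "0 < d" "s \<in> {0..T}"
  shows "(\<lambda>k. obs (tail (real (j + k) * d)) s) \<longlonglongrightarrow> 0"
proof -
  have "(\<lambda>k. \<integral>v. tail (real (j + k) * d) v \<partial>f s) \<longlonglongrightarrow> (\<integral>v. 0 \<partial>f s)"
  proof (rule integral_dominated_convergence)
    show "integrable (f s) (\<lambda>v. 1 + v powr \<gamma>)" by (rule tame_integrable_weight[OF tame[OF assms(2)] B'])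
    show "tail (real (j + k) * d) \<in> borel_measurable (f s)" for k
      using assms by (intro borel_measurable_integrable[OF lip0_integrable[OF tame B' tail_lip0]]) auto
    show "AE v in f s. (\<lambda>k. tail (real (j + k) * d) v) \<longlonglongrightarrow> 0"
    proof (rule AE_I2)
      fix v
      have "\<forall>\<^sub>F k in sequentially. real k \<ge> v / d"
        using filterlim_real_sequentially by (simp add: filterlim_at_top)
      then have "\<forall>\<^sub>F k in sequentially. tail (real (j + k) * d) v = 0"
      proof eventually_elim
        case (elim k)
        then have "v \<le> real k * d" using assms by (simp add: field_simps)
        also have "\<dots> \<le> real (j + k) * d" using assms by (intro mult_right_mono) auto
        finally show ?case by (simp add: tail_def)
      qed
      then show "(\<lambda>k. tail (real (j + k) * d) v) \<longlonglongrightarrow> 0" by (rule tendsto_eventually)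
    qed
    show "AE v in f s. norm (tail (real (j + k) * d) v) \<le> 1 + v powr \<gamma>" for k
    proof (rule AE_I2)
      fix v assume "v \<in> space (f s)"
      then have "0 < v" by (simp add: tame_space[OF tame[OF assms(2)] B'])
      then show "norm (tail (real (j + k) * d) v) \<le> 1 + v powr \<gamma>"
        using lip0_le[OF tail_lip0[of "real (j + k) * d"], of v] le_one_plus_powr[of v \<gamma>] \<gamma> assms by auto
    qed
  qed simp
  then show ?thesis by (simp add: obs_def)
qed

text \<open>Starting from \<open>y\<close> and adding \<open>x\<close> repeatedly, arbitrarily large sizes are charged at every positive time; the
sizes \<open>z\<close> obtained in this way differ from \<open>x\<close>, so the kernel is positive in every step. A fixed positive
amount of particles of size about \<open>x\<close> is present on the whole time interval. Thus the tails at the levels \<open>(j + k) * d\<close>, with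
\<open>d = x / 2\<close>, form a chain with rates of order \<open>(j + k) powr \<gamma>\<close>. As \<open>\<gamma> > 1\<close>, the reciprocal rates are summable,
and their sum is less than \<open>T / 2\<close> once \<open>j\<close> is large: the chain explodes between \<open>T / 2\<close> and \<open>T\<close>, whereas the
tails of a tame measure vanish at infinity.\<close>

lemma not_two_charged:
  assumes x: "charged f_in x" and y: "charged f_in y" and "x \<noteq> y"
  shows False
proof -
  have init: "charged (f 0) z" if "charged f_in z" for z
    using that obs_0[OF bump_Cc_pos] by (auto simp: charged_def obs_def)
  have xs: "charged (f s) x" and ys: "charged (f s) y" if "s \<in> {0..T}" for s
    using charged_mono[OF init[OF x], of s] charged_mono[OF init[OF y], of s] that by auto
  have x0: "0 < x" using x by (simp add: charged_def)
  have y0: "0 < y" using y by (simp add: charged_def)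
  have chain: "\<exists>z\<ge>real k * x. z \<noteq> x \<and> (\<forall>s\<in>{0<..T}. charged (f s) z)" for k
  proof (induction k)
    case 0
    show ?case using ys y0 \<open>x \<noteq> y\<close> by (intro exI[of _ y]) auto
  next
    case (Suc k)
    then obtain z where z: "real k * x \<le> z" "z \<noteq> x" "\<forall>s\<in>{0<..T}. charged (f s) z" by blast
    have "charged (f s) (x + z)" if "s \<in> {0<..T}" for s
      using z xs that by (intro charged_add) auto
    moreover have "0 < z" using z(3) T by (auto simp: charged_def)
    ultimately show ?case using z by (intro exI[of _ "x + z"]) (auto simp: algebra_simps)
  qed
  define d where "d = x / 2"
  have d: "0 < d" using x0 by (simp add: d_def)
  have "balanced (bump (2 * d) d)" using d by (intro balanced_Cc_pos bump_lip0 bump_Cc_pos) auto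
  then have "continuous_on {0..T} (obs (bump (2 * d) d))" by (rule obs_continuous)
  then have "\<exists>q\<in>{0..T}. \<forall>s\<in>{0..T}. obs (bump (2 * d) d) q \<le> obs (bump (2 * d) d) s"
    using T by (intro continuous_attains_inf) auto
  then obtain q where q: "q \<in> {0..T}" "\<And>s. s \<in> {0..T} \<Longrightarrow> obs (bump (2 * d) d) q \<le> obs (bump (2 * d) d) s"
    by blast
  define m where "m = obs (bump (2 * d) d) q"
  have m: "0 < m" "\<And>s. s \<in> {0..T} \<Longrightarrow> m \<le> obs (bump (2 * d) d) s"
    using xs[OF q(1)] q d by (auto simp: charged_def m_def obs_def d_def)
  obtain N \<kappa> where \<kappa>: "0 < \<kappa>" "\<And>v w. N \<le> v \<Longrightarrow> 0 < w \<Longrightarrow> w \<le> 3 * d \<Longrightarrow> \<kappa> * v powr \<gamma> \<le> K v w"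
    using K_large[of "3 * d"] d by auto
  \<comment> \<open>The factor \<open>1/2\<close> is the one in front of the time integral of the weak formulation.\<close>
  define c where "c = 1/2 * \<kappa> * d powr \<gamma> * (m / d)"
  have c: "0 < c" using \<kappa> d m by (simp add: c_def)
  have "summable (\<lambda>n. 1 / c * real n powr - \<gamma>)"
    using \<gamma> by (intro summable_mult) (simp add: summable_real_powr_iff)
  then obtain j0 where j0: "\<And>n. j0 \<le> n \<Longrightarrow> norm (\<Sum>i. 1 / c * real (i + n) powr - \<gamma>) < T / 2"
    using suminf_exist_split[of "T / 2" "\<lambda>n. 1 / c * real n powr - \<gamma>"] T by auto
  \<comment> \<open>By \<open>2 \<le> j\<close> every level after the first lies above the absorbed particles, which are smaller than \<open>3 * d\<close>.\<close>
  define j where "j = max j0 (max 2 (nat \<lceil>N / d\<rceil>))"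
  have j: "j0 \<le> j" "2 \<le> j" by (auto simp: j_def)
  have "nat \<lceil>N / d\<rceil> \<le> j" unfolding j_def by linarith
  then have jN: "N / d \<le> real j" using real_nat_ceiling_ge[of "N / d"] by linarith
  define \<mu> where "\<mu> k = c * real (j + k) powr \<gamma>" for k
  have inv\<mu>: "1 / \<mu> k = 1 / c * real (k + j) powr - \<gamma>" for k
    by (simp add: \<mu>_def powr_minus_divide add.commute)
  define y where "y k = obs (tail (real (j + k) * d))" for k
  have pos: "0 < real (j + k) * d" for k using j d by simp
  have step: "real (j + Suc k) * d = real (j + k) * d + d" for k by (simp add: algebra_simps)
  have "y 0 (T / 2) = 0"
  proof (rule explosive_chain_extinct[where y = y and \<mu> = \<mu> and a = "T / 2" and b = T])
    show "continuous_on {T / 2..T} (y k)" for k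
      unfolding y_def by (rule continuous_on_subset[OF obs_continuous[OF balanced_tail[OF pos]]]) (use T in auto)
    show "y k s \<le> y k t" if "T / 2 \<le> s" "s \<le> t" "t \<le> T" for k s t
      unfolding y_def using that T by (intro obs_tail_mono[OF pos]) auto
    show "0 \<le> y k t" for k t unfolding y_def by (rule obs_nonneg) simp
    show "(\<lambda>k. y k T) \<longlonglongrightarrow> 0" unfolding y_def using d T by (intro obs_tail_LIMSEQ) auto
    show "0 < \<mu> k" for k using c j by (simp add: \<mu>_def)
    show "summable (\<lambda>k. 1 / \<mu> k)" unfolding inv\<mu>
      using \<open>summable (\<lambda>n. 1 / c * real n powr - \<gamma>)\<close> by (rule summable_ignore_initial_segment)
    show "(\<Sum>k. 1 / \<mu> k) < T - T / 2" unfolding inv\<mu> using j0[OF j(1)] by (simp add: abs_less_iff)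
    fix k t assume t: "T / 2 \<le> t" "t \<le> T"
    have "N \<le> real j * d" using jN d by (simp add: field_simps)
    also have "\<dots> \<le> real (j + k) * d" using d by (intro mult_right_mono) auto
    finally have N: "N \<le> real (j + k) * d" .
    have "2 * d \<le> real (j + k) * d" using j d by (intro mult_right_mono) auto
    have le: "2 * \<mu> k * (y k r - y (Suc k) r) \<le> rate (tail (real (j + Suc k) * d)) r" if r: "r \<in> {0..T}" for r
    proof -
      have "\<kappa> * (real (j + k) * d) powr \<gamma> * (m / d)
          * (obs (tail (real (j + k) * d)) r - obs (tail (real (j + k) * d + d)) r)
          \<le> rate (tail (real (j + k) * d + d)) r"
        using N \<kappa> m r d \<open>2 * d \<le> real (j + k) * d\<close> by (intro tail_rate_lower) auto
      moreover have "2 * \<mu> k = \<kappa> * (real (j + k) * d) powr \<gamma> * (m / d)"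
        using d by (simp add: \<mu>_def c_def powr_mult mult_ac)
      ultimately show ?thesis unfolding y_def step by simp
    qed
    have cont: "continuous_on {0..T} (y k)" for k
      unfolding y_def by (rule obs_continuous[OF balanced_tail[OF pos]])
    have "2 * \<mu> k * (LBINT r:{T / 2<..t}. y k r - y (Suc k) r)
        = (LBINT r:{T / 2<..t}. 2 * \<mu> k * (y k r - y (Suc k) r))"
      by (rule set_integral_mult_right[symmetric])
    also have "\<dots> \<le> (LBINT r:{T / 2<..t}. rate (tail (real (j + Suc k) * d)) r)"
      using t T pos[of "Suc k"]
      by (intro set_integral_mono set_integrable_mult_right set_integral_diff(1)
          set_integrable_Ioc_continuous[OF cont] rate_integrable[OF tail_lip0] le) auto
    also have "\<dots> = 2 * (y (Suc k) t - y (Suc k) (T / 2))"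
    proof -
      have "y (Suc k) t - y (Suc k) (T / 2)
          = 1/2 * (LBINT r:{T / 2<..t}. rate (tail (real (j + Suc k) * d)) r)"
        unfolding y_def using t T by (intro balancedD balanced_tail pos) auto
      then show ?thesis unfolding \<open>y (Suc k) t - y (Suc k) (T / 2) = _\<close> by simp
    qed
    finally show "\<mu> k * (LBINT r:{T / 2<..t}. y k r - y (Suc k) r) \<le> y (Suc k) t - y (Suc k) (T / 2)"
      by simp
  qed
  moreover have "0 < y 0 (T / 2)"
  proof -
    obtain z where z: "real (j + 1) * x \<le> z" "charged (f (T / 2)) z"
      using chain[of "j + 1"] T by auto
    have "real j * d < real (j + 1) * x" using x0 by (simp add: d_def algebra_simps add_nonneg_pos)
    with z have jz: "real j * d < z" by simp
    have T2: "T / 2 \<in> {0..T}" using T by simp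
    have jd: "0 < real j * d" using pos[of 0] by simp
    show ?thesis unfolding y_def obs_def
    proof (rule integral_pos_if_pos_where[where \<phi> = "bump z (z - real j * d)"])
      show "integrable (f (T / 2)) (tail (real (j + 0) * d))"
        using jd by (intro lip0_integrable[OF tame[OF T2] B'] tail_lip0) auto
      show "0 < (\<integral>v. bump z (z - real j * d) v \<partial>f (T / 2))"
        using z(2) jz jd by (auto simp: charged_def)
      show "0 < tail (real (j + 0) * d) v" if "0 < bump z (z - real j * d) v" for v
        using that by (auto simp: bump_pos_iff tail_def)
    qed auto
  qed
  ultimately show False by simp
qed

end

section \<open>Radon measures that charge at most one size\<close>

lemma radon_bump_null:
  assumes \<mu>: "radon_measure \<mu>" and e: "0 < e" "e < x" and le: "\<not> 0 < (\<integral>v. bump x e v \<partial>\<mu>)"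
  shows "{x - e<..<x + e} \<in> null_sets \<mu>"
proof -
  have sets: "sets \<mu> = sets pos_borel" using \<mu> by (simp add: radon_measure_def)
  have space: "space \<mu> = {0<..}" using sets_eq_imp_space_eq[OF sets] by simp
  have in_sets: "A \<in> sets \<mu>" if "A \<in> sets borel" "A \<subseteq> {0<..}" for A
    using that by (simp add: sets sets_restrict_space_iff)
  have C: "{x - e..x + e} \<subseteq> {0<..}" using e by auto
  have "emeasure \<mu> {x - e..x + e} < \<infinity>" using \<mu> C by (simp add: radon_measure_def)
  then have "integrable \<mu> (\<lambda>v. e * indicator {x - e..x + e} v)"
    using in_sets[OF _ C] by (intro integrable_mult_right integrable_real_indicator) auto
  then have int: "integrable \<mu> (bump x e)"
  proof (rule Bochner_Integration.integrable_bound)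
    have "bump x e \<in> borel_measurable pos_borel"
      by (intro borel_measurable_continuous_on_restrict continuous_on_bump)
    then show "bump x e \<in> borel_measurable \<mu>" by (simp cong: measurable_cong_sets add: sets)
  qed (auto simp: bump_def indicator_def)
  have "0 \<le> (\<integral>v. bump x e v \<partial>\<mu>)" by (intro Bochner_Integration.integral_nonneg) auto
  with le have "(\<integral>v. bump x e v \<partial>\<mu>) = 0" by linarith
  then have "AE v in \<mu>. bump x e v = 0"
    by (subst (asm) integral_nonneg_eq_0_iff_AE[OF int]) auto
  then have "AE v in \<mu>. v \<notin> {x - e<..<x + e}"
    by eventually_elim (auto simp: bump_def)
  moreover have "{x - e<..<x + e} \<in> sets \<mu>" using e by (intro in_sets) auto
  ultimately show ?thesis by (subst AE_iff_null_sets) auto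
qed

text \<open>Every uncharged point has a null open neighbourhood, and by the Lindelof property countably many null open
sets cover all of them.\<close>

lemma radon_uncharged_null:
  assumes \<mu>: "radon_measure \<mu>"
  obtains U where "U \<in> null_sets \<mu>" "\<And>x. 0 < x \<Longrightarrow> x \<notin> U \<Longrightarrow> charged \<mu> x"
proof -
  define F where "F = {I. open I \<and> I \<in> null_sets \<mu>}"
  obtain F' where F': "F' \<subseteq> F" "countable F'" "\<Union>F' = \<Union>F"
    using Lindelof[of F] by (auto simp: F_def)
  have "\<Union>F' \<in> null_sets \<mu>"
    using F'(1) null_sets_UN'[OF F'(2), of "\<lambda>I. I" \<mu>] by (auto simp: F_def)
  moreover have "charged \<mu> x" if x: "0 < x" "x \<notin> \<Union>F'" for x
    unfolding charged_def
  proof (intro conjI allI impI x)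
    fix e assume e: "0 < e \<and> e < x"
    show "0 < (\<integral>v. bump x e v \<partial>\<mu>)"
    proof (rule ccontr)
      assume "\<not> ?thesis"
      with e have "{x - e<..<x + e} \<in> F"
        by (auto simp: F_def intro: radon_bump_null[OF \<mu>])
      with x(2) e show False unfolding F'(3) by force
    qed
  qed
  ultimately show ?thesis by (rule that)
qed

lemma dirac_if_charged_unique:
  assumes \<mu>: "radon_measure \<mu>" and "\<mu> \<noteq> null_measure pos_borel"
    and unique: "\<And>x y. charged \<mu> x \<Longrightarrow> charged \<mu> y \<Longrightarrow> x = y"
  shows "\<exists>M>0. \<exists>V>0. \<mu> = scale_measure (ennreal M) (dirac_mass V)"
proof -
  have sets: "sets \<mu> = sets pos_borel" using \<mu> by (simp add: radon_measure_def)
  have space: "space \<mu> = {0<..}" using sets_eq_imp_space_eq[OF sets] by simp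
  have not_null: "{0<..} \<notin> null_sets \<mu>"
  proof
    assume *: "{0<..} \<in> null_sets \<mu>"
    have "\<mu> = null_measure pos_borel"
    proof (rule measure_eqI)
      fix X assume "X \<in> sets \<mu>"
      then have "X \<in> null_sets \<mu>"
        using null_sets_subset[OF *, of X] sets.sets_into_space[of X \<mu>] space by auto
      then show "emeasure \<mu> X = emeasure (null_measure pos_borel) X" by auto
    qed (simp add: sets)
    with assms show False by simp
  qed
  obtain U where U: "U \<in> null_sets \<mu>" "\<And>x. 0 < x \<Longrightarrow> x \<notin> U \<Longrightarrow> charged \<mu> x"
    using radon_uncharged_null[OF \<mu>] by blast
  have "\<not> {0<..} \<subseteq> U"
  proof
    assume "{0<..} \<subseteq> U"
    then have "{0<..} \<in> null_sets \<mu>"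
      using null_sets_subset[OF U(1)] sets.top[of \<mu>] space by auto
    with not_null show False ..
  qed
  then obtain V where V: "0 < V" "V \<notin> U" by auto
  have cover: "{0<..} - {V} \<subseteq> U" using U(2) V unique by (metis Diff_iff greaterThan_iff insertI1 subsetI)
  have V_sets: "{V} \<in> sets \<mu>" using V by (simp add: sets sets_restrict_space_iff)
  have "emeasure \<mu> {V} < \<infinity>" using \<mu> V by (simp add: radon_measure_def)
  then have M: "emeasure \<mu> {V} = ennreal (measure \<mu> {V})"
    by (intro emeasure_eq_ennreal_measure) auto
  have eq: "\<mu> = scale_measure (ennreal (measure \<mu> {V})) (dirac_mass V)"
  proof (rule measure_eqI)
    show "sets \<mu> = sets (scale_measure (ennreal (measure \<mu> {V})) (dirac_mass V))"
      by (simp add: sets dirac_mass_def)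
    fix X assume X: "X \<in> sets \<mu>"
    have "X - {V} \<subseteq> U" using cover sets.sets_into_space[OF X] space by auto
    then have null: "emeasure \<mu> (X - {V}) = 0"
      using null_sets_subset[OF U(1), of "X - {V}"] X V_sets by auto
    have "emeasure \<mu> X = emeasure \<mu> {V} * indicator X V"
    proof (cases "V \<in> X")
      case True
      then have "X = insert V (X - {V})" by auto
      then have "emeasure \<mu> X = emeasure \<mu> {V} + emeasure \<mu> (X - {V})"
        using plus_emeasure[of "{V}" \<mu> "X - {V}"] V_sets X by auto
      with True null show ?thesis by simp
    next
      case False
      with null show ?thesis by simp
    qed
    then show "emeasure \<mu> X = emeasure (scale_measure (ennreal (measure \<mu> {V})) (dirac_mass V)) X"
      using X by (simp add: M dirac_mass_def sets)
  qed
  have "0 < measure \<mu> {V}"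
  proof (rule ccontr)
    assume "\<not> ?thesis"
    then have "measure \<mu> {V} = 0" using measure_nonneg[of \<mu> "{V}"] by linarith
    then have "emeasure \<mu> {0<..} = 0" by (subst eq) simp
    with not_null show False using sets.top[of \<mu>] space by auto
  qed
  with eq V show ?thesis by blast
qed

section \<open>Characterisation of the initial data\<close>

lemma time_interval_ereal: "time_interval (ereal T) = {0..T}"
  by (auto simp: time_interval_def)

lemma coagulation_flow_if_solution:
  assumes "off_diagonal_kernel \<gamma> A K" "0 < T" and sol: "mass_conserving_solution \<gamma> K T f_in f"
  shows "\<exists>B. coagulation_flow \<gamma> A K T B f_in f"
proof -
  interpret off_diagonal_kernel \<gamma> A K by fact
  have w: "weak_solution \<gamma> K (ereal T) f_in f"
    using sol by (simp add: mass_conserving_solution_def)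
  define S where "S = (SUP t\<in>{0..T}. \<integral>\<^sup>+v. ennreal (1 + v powr \<gamma>) \<partial>f t)"
  have S: "S < \<infinity>" using w by (simp add: weak_solution_def time_interval_ereal S_def)
  have "coagulation_flow \<gamma> A K T (enn2real S + 1) f_in f"
  proof
    show "0 < T" by fact
    show "0 < enn2real S + 1" by (simp add: add_nonneg_pos)
    show "tame \<gamma> (enn2real S + 1) (f s)" if "s \<in> {0..T}" for s
      unfolding tame_def
    proof
      show "sets (f s) = sets pos_borel"
        using w that
        by (simp add: weak_solution_def time_interval_ereal radon_measure_weighted_def radon_measure_def)
      have "(\<integral>\<^sup>+v. ennreal (1 + v powr \<gamma>) \<partial>f s) \<le> S" unfolding S_def using that by (rule SUP_upper)
      also have "\<dots> = ennreal (enn2real S)" using S by simp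
      also have "\<dots> \<le> ennreal (enn2real S + 1)" by (rule ennreal_leI) simp
      finally show "(\<integral>\<^sup>+v. ennreal (1 + v powr \<gamma>) \<partial>f s) \<le> ennreal (enn2real S + 1)" .
    qed
    show "continuous_on {0..T} (\<lambda>s. \<integral>v. \<phi> v \<partial>f s)" if "\<phi> \<in> Cc_pos" for \<phi>
      using w that by (simp add: weak_solution_def time_interval_ereal)
    show "(\<integral>v. \<phi> v \<partial>f t) - (\<integral>v. \<phi> v \<partial>f_in) = 1/2 * (LBINT s:{0..t}. dint (f s) (collision \<phi>))"
      if "\<phi> \<in> Cc_pos" "t \<in> {0..T}" for \<phi> t
      using w that unfolding weak_solution_def time_interval_ereal dint_def collision_def by blast
  qed
  then show ?thesis ..
qed

text \<open>Particles of one size only meet on the diagonal, where the kernel vanishes.\<close>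

lemma dirac_stationary:
  assumes radon: "radon_measure \<mu>" and \<mu>: "\<mu> = scale_measure (ennreal M) (dirac_mass V)"
    and V: "0 < V" and K: "K V V = 0" and T: "0 < T"
  shows "mass_conserving_solution \<gamma> K T \<mu> (\<lambda>_. \<mu>)"
proof -
  have fin: "(\<integral>\<^sup>+v. ennreal (1 + v powr \<gamma>) \<partial>\<mu>) < \<infinity>"
  proof -
    have "(\<lambda>v. ennreal (1 + v powr \<gamma>)) \<in> borel_measurable pos_borel" by measurable
    then show ?thesis
      using V by (simp add: \<mu> dirac_mass_def nn_integral_scale_measure nn_integral_return ennreal_mult_less_top)
  qed
  have "{0<..} - {V} \<in> null_sets \<mu>"
    using V by (auto simp: null_sets_def \<mu> dirac_mass_def sets_restrict_space_iff)
  moreover have "space \<mu> = {0<..}" by (simp add: \<mu> dirac_mass_def space_scale_measure)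
  ultimately have ae: "AE v in \<mu>. v = V"
    by (intro AE_I'[of "{0<..} - {V}"]) auto
  have zero: "(\<integral>w. (\<integral>v. K v w * (\<phi> (v + w) - \<phi> v - \<phi> w) \<partial>\<mu>) \<partial>\<mu>) = 0" for \<phi>
  proof (rule integral_eq_zero_AE)
    show "AE w in \<mu>. (\<integral>v. K v w * (\<phi> (v + w) - \<phi> v - \<phi> w) \<partial>\<mu>) = 0"
      using ae
    proof eventually_elim
      case (elim w)
      show ?case using ae
        by (intro integral_eq_zero_AE, eventually_elim) (simp add: elim K)
    qed
  qed
  show ?thesis
    unfolding mass_conserving_solution_def weak_solution_def time_interval_ereal radon_measure_weighted_def
    using radon fin T by (simp add: zero set_lebesgue_integral_def)
qed

theorem corollary1p7:
  fixes \<gamma> T :: real and K :: "real \<Rightarrow> real \<Rightarrow> real" and f_in :: "real measure"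
  assumes "\<gamma> > 1"
    and "assumption_K \<gamma> K"
    and "radon_measure f_in"
    and "f_in \<noteq> null_measure pos_borel"
    and "T > 0"
  shows "(\<exists>f. mass_conserving_solution \<gamma> K T f_in f) \<longleftrightarrow>
         (\<exists>M>0. \<exists>V>0. f_in = scale_measure (ennreal M) (dirac_mass V))"
proof
  assume "\<exists>f. mass_conserving_solution \<gamma> K T f_in f"
  then obtain f A B where "coagulation_flow \<gamma> A K T B f_in f"
    using coagulation_flow_if_solution off_diagonal_kernel_if_assumption_K(1) assms by metis
  then have "x = y" if "charged f_in x" "charged f_in y" for x y
    using coagulation_flow.not_two_charged that by blast
  with assms show "\<exists>M>0. \<exists>V>0. f_in = scale_measure (ennreal M) (dirac_mass V)"
    by (intro dirac_if_charged_unique)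
next
  assume "\<exists>M>0. \<exists>V>0. f_in = scale_measure (ennreal M) (dirac_mass V)"
  then obtain M V where "0 < V" and f: "f_in = scale_measure (ennreal M) (dirac_mass V)" by blast
  then have "mass_conserving_solution \<gamma> K T f_in (\<lambda>_. f_in)"
    using off_diagonal_kernel_if_assumption_K(2) assms by (intro dirac_stationary)
  then show "\<exists>f. mass_conserving_solution \<gamma> K T f_in f" by blast
qed

end
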